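(* Let $X$ and $Y$ be binary random variables (with values in $\{0,1\}$ and arbitrary joint distribution) and let $Z=X\oplus Y$. Define $$\Delta_1=\min_{U:\,U - X - (Y,Z)}\big[H(Z|U)-H(Y|U)\big],\qquad \Delta_2=\min_{V:\,V - Y - (X,Z)}\big[H(Z|V)-H(X|V)\big],\qquad \bar\Delta=\max\{\Delta_1,\Delta_2\},$$ where $A-B-C$ means that $A$ and $C$ are conditionally independent given $B$. Let $$\Delta=\frac{\bar\Delta+S_{\mathrm{ni}}(X;Y\|Z)}{2}.$$ Then $S_{\mathrm{ni}}(X;Y\|Z)=S_{\mathrm{ni},\Delta}(X;Y\|Z)$.
   Context: All random variables have finite alphabets. $H$ and $I$ denote Shannon entropy and mutual information. The minima are over finite-alphabet auxiliary random variables. Non-interactive code of blocklength $n$: $(X^n,Y^n,Z^n)$ are $n$ i.i.d. copies of $(X,Y,Z)$. Alice (observing $X^n$) generates $F_1$ according to some $P_{F_1|X^n}$ and Bob (observing $Y^n$) generates $F_2$ according to some $P_{F_2|Y^n}$, using independent local randomness. The messages are exchanged publicly; then Alice generates a key $K_A$ according to some $P_{K_A|X^n,F_1,F_2}$ and Bob generates $K_B$ according to some $P_{K_B|Y^n,F_1,F_2}$, both in an alphabet $\mathcal K$, again with independent local randomness. It is a non-interactive $(n,R,\delta)$ code if $R=\frac1nH(K_A)$ and $$\mathbb P[K_A=K_B]\ge1-\delta,\qquad R\ge\tfrac1n\log|\mathcal K|-\delta,\qquad \tfrac1n I(K_A;Z^n,F_1,F_2)\le\delta.$$ A rate $R$ is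 achievable if for every $\delta>0$ there is an $(n,R,\delta)$ code for some $n$; $S_{\mathrm{ni}}(X;Y\|Z)$ is the supremum of rates achievable by non-interactive codes. For real $\Delta$, $S_{\mathrm{ni},\Delta}(X;Y\|Z)$ is the supremum of secret key rates of non-interactive protocols satisfying $\lim_{n\to\infty}\frac1nH(Z^n|F_1,F_2)\ge\Delta$; that is, the supremum of all $R$ for which there is a sequence of non-interactive $(n_k,R_k,\delta_k)$ codes with $n_k\to\infty$, $\delta_k\to0$, $R_k\to R$ and $\lim_k\frac1{n_k}H(Z^{n_k}|F_1,F_2)\ge\Delta$. *)

theory Defs
  imports "HOL-Probability.Probability"
begin

section \<open>Information measures of finitely supported random variables\<close>

text \<open>
  Random variables are functions on the sample space of a pmf. Entropies are in bits. The library
  quantities are taken relative to counting measure on the whole (countable) value type; values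
  of probability zero contribute nothing, so for finite supports these are the usual finite sums,
  see \<open>ent_eq_sum\<close>, \<open>cond_ent_eq_sum\<close>, \<open>mut_info_eq_sum\<close> below.
\<close>

definition ent :: "'w pmf \<Rightarrow> ('w \<Rightarrow> 'a::countable) \<Rightarrow> real" where
  "ent p A = prob_space.entropy (measure_pmf p) 2 (count_space UNIV) A"

definition cond_ent :: "'w pmf \<Rightarrow> ('w \<Rightarrow> 'a::countable) \<Rightarrow> ('w \<Rightarrow> 'b::countable) \<Rightarrow> real" where
  "cond_ent p A B =
     prob_space.conditional_entropy (measure_pmf p) 2 (count_space UNIV) (count_space UNIV) A B"

definition mut_info :: "'w pmf \<Rightarrow> ('w \<Rightarrow> 'a::countable) \<Rightarrow> ('w \<Rightarrow> 'b::countable) \<Rightarrow> real" where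
  "mut_info p A B =
     prob_space.mutual_information (measure_pmf p) 2 (count_space UNIV) (count_space UNIV) A B"

definition markov_chain ::
  "'w pmf \<Rightarrow> ('w \<Rightarrow> 'a) \<Rightarrow> ('w \<Rightarrow> 'b) \<Rightarrow> ('w \<Rightarrow> 'c) \<Rightarrow> bool" where
  "markov_chain p A B C \<longleftrightarrow>
     (\<forall>b \<in> B ` set_pmf p. let q = cond_pmf p {w. B w = b} in
        map_pmf (\<lambda>w. (A w, C w)) q = pair_pmf (map_pmf A q) (map_pmf C q))"

lemma distributed_pmf:
  "distributed (measure_pmf p) (count_space UNIV) A (pmf (map_pmf A p))"
proof -
  have "distr (measure_pmf p) (count_space UNIV) A = measure_pmf (map_pmf A p)"
    by (simp add: map_pmf_rep_eq)
  then show ?thesis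
    by (simp add: distributed_def measure_pmf_eq_density)
qed

lemma integral_pmf_finite_support:
  fixes f :: "'a \<Rightarrow> real"
  assumes "finite (set_pmf q)" "\<And>x. x \<notin> set_pmf q \<Longrightarrow> f x = 0"
  shows "(\<integral>x. f x \<partial>count_space UNIV) = (\<Sum>x\<in>set_pmf q. f x)"
proof -
  have sub: "{x. f x \<noteq> 0} \<subseteq> set_pmf q" using assms(2) by auto
  have fin: "finite {x. f x \<noteq> 0}" using finite_subset[OF sub assms(1)] .
  have "(\<integral>x. f x \<partial>count_space UNIV) = (\<Sum>x | f x \<noteq> 0. f x)"
    using lebesgue_integral_count_space_finite_support[of UNIV f] fin by simp
  also have "\<dots> = (\<Sum>x\<in>set_pmf q. f x)"
    by (rule sum.mono_neutral_left) (use assms sub in auto)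
  finally show ?thesis .
qed

lemma information_space_pmf: "information_space (measure_pmf p) 2"
  by (simp add: information_space_def information_space_axioms_def measure_pmf.prob_space_axioms)

lemma ent_eq_sum:
  fixes A :: "'w \<Rightarrow> 'a::countable"
  assumes fin: "finite (set_pmf p)"
  shows "ent p A = - (\<Sum>a\<in>A ` set_pmf p. pmf (map_pmf A p) a * log 2 (pmf (map_pmf A p) a))"
proof -
  let ?q = "map_pmf A p"
  have "ent p A = - (\<integral>x. pmf ?q x * log 2 (pmf ?q x) \<partial>count_space UNIV)"
    unfolding ent_def
    by (rule information_space.entropy_distr[OF information_space_pmf distributed_pmf]) simp
  also have "(\<integral>x. pmf ?q x * log 2 (pmf ?q x) \<partial>count_space UNIV)
      = (\<Sum>x\<in>set_pmf ?q. pmf ?q x * log 2 (pmf ?q x))"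
    by (rule integral_pmf_finite_support) (use fin in \<open>simp_all add: pmf_eq_0_set_pmf\<close>)
  finally show ?thesis by simp
qed

lemma count_space_pair_countable:
  "count_space (UNIV :: 'a::countable set) \<Otimes>\<^sub>M count_space (UNIV :: 'b::countable set) = count_space UNIV"
  by (simp add: pair_measure_countable)

lemma cond_ent_eq_sum:
  fixes A :: "'w \<Rightarrow> 'a::countable" and B :: "'w \<Rightarrow> 'b::countable"
  assumes fin: "finite (set_pmf p)"
  shows "cond_ent p A B = - (\<Sum>(a, b)\<in>(\<lambda>w. (A w, B w)) ` set_pmf p.
     pmf (map_pmf (\<lambda>w. (A w, B w)) p) (a, b) *
     log 2 (pmf (map_pmf (\<lambda>w. (A w, B w)) p) (a, b) / pmf (map_pmf B p) b))"
proof -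
  let ?q = "map_pmf (\<lambda>w. (A w, B w)) p"
  have "cond_ent p A B = - (\<integral>(a, b). pmf ?q (a, b) * log 2 (pmf ?q (a, b) / pmf (map_pmf B p) b)
      \<partial>(count_space UNIV \<Otimes>\<^sub>M count_space UNIV))"
    unfolding cond_ent_def
    by (rule information_space.conditional_entropy_generic_eq[OF information_space_pmf])
      (auto simp: count_space_pair_countable intro!: distributed_pmf sigma_finite_measure_count_space)
  also have "(\<integral>(a, b). pmf ?q (a, b) * log 2 (pmf ?q (a, b) / pmf (map_pmf B p) b)
      \<partial>(count_space UNIV \<Otimes>\<^sub>M count_space UNIV))
     = (\<Sum>(a, b)\<in>set_pmf ?q. pmf ?q (a, b) * log 2 (pmf ?q (a, b) / pmf (map_pmf B p) b))"
    unfolding count_space_pair_countable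
    by (rule integral_pmf_finite_support)
      (use fin in \<open>auto simp: pmf_eq_0_set_pmf\<close>)
  finally show ?thesis by simp
qed

lemma mut_info_eq_sum:
  fixes A :: "'w \<Rightarrow> 'a::countable" and B :: "'w \<Rightarrow> 'b::countable"
  assumes fin: "finite (set_pmf p)"
  shows "mut_info p A B = (\<Sum>(a, b)\<in>(\<lambda>w. (A w, B w)) ` set_pmf p.
     pmf (map_pmf (\<lambda>w. (A w, B w)) p) (a, b) *
     log 2 (pmf (map_pmf (\<lambda>w. (A w, B w)) p) (a, b) /
       (pmf (map_pmf A p) a * pmf (map_pmf B p) b)))"
proof -
  let ?q = "map_pmf (\<lambda>w. (A w, B w)) p"
  let ?f = "\<lambda>(a, b). pmf ?q (a, b) *
      log 2 (pmf ?q (a, b) / (pmf (map_pmf A p) a * pmf (map_pmf B p) b))"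
  have "mut_info p A B = (\<integral>x. ?f x \<partial>(count_space UNIV \<Otimes>\<^sub>M count_space UNIV))"
    unfolding mut_info_def case_prod_beta prod.collapse
    by (rule information_space.mutual_information_distr[OF information_space_pmf, unfolded case_prod_beta prod.collapse])
      (auto simp: count_space_pair_countable intro!: distributed_pmf sigma_finite_measure_count_space)
  also have "\<dots> = (\<Sum>x\<in>set_pmf ?q. ?f x)"
    unfolding count_space_pair_countable
    by (rule integral_pmf_finite_support)
      (use fin in \<open>auto simp: pmf_eq_0_set_pmf\<close>)
  finally show ?thesis by simp
qed

section \<open>Non-interactive secret key agreement\<close>

text \<open>
  Message and key alphabets are finite sets of natural numbers (every finite alphabet is of this
  form up to relabelling). Stochastic maps into pmfs model generation by independent local
  randomness.
\<close>

record ('x, 'y) ni_scheme =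
  alph_F1 :: "nat set"
  alph_F2 :: "nat set"
  alph_K :: "nat set"
  enc_A :: "'x list \<Rightarrow> nat pmf"
  enc_B :: "'y list \<Rightarrow> nat pmf"
  key_A :: "'x list \<Rightarrow> nat \<Rightarrow> nat \<Rightarrow> nat pmf"
  key_B :: "'y list \<Rightarrow> nat \<Rightarrow> nat \<Rightarrow> nat pmf"

definition finite_scheme :: "('x, 'y) ni_scheme \<Rightarrow> bool" where
  "finite_scheme c \<longleftrightarrow>
     finite (alph_F1 c) \<and> finite (alph_F2 c) \<and> finite (alph_K c) \<and>
     (\<forall>xs. set_pmf (enc_A c xs) \<subseteq> alph_F1 c) \<and>
     (\<forall>ys. set_pmf (enc_B c ys) \<subseteq> alph_F2 c) \<and>
     (\<forall>xs f1 f2. set_pmf (key_A c xs f1 f2) \<subseteq> alph_K c) \<and>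
     (\<forall>ys f1 f2. set_pmf (key_B c ys f1 f2) \<subseteq> alph_K c)"

type_synonym ('x, 'y, 'z) outcome =
  "'x list \<times> 'y list \<times> 'z list \<times> nat \<times> nat \<times> nat \<times> nat"

definition ni_law ::
  "('x \<times> 'y \<times> 'z) pmf \<Rightarrow> nat \<Rightarrow> ('x, 'y) ni_scheme \<Rightarrow> ('x, 'y, 'z) outcome pmf" where
  "ni_law P n c = do {
     s \<leftarrow> replicate_pmf n P;
     let xs = map fst s;
     let ys = map (fst \<circ> snd) s;
     let zs = map (snd \<circ> snd) s;
     f1 \<leftarrow> enc_A c xs;
     f2 \<leftarrow> enc_B c ys;
     kA \<leftarrow> key_A c xs f1 f2;
     kB \<leftarrow> key_B c ys f1 f2;
     return_pmf (xs, ys, zs, f1, f2, kA, kB)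
   }"

definition Zn :: "('x, 'y, 'z) outcome \<Rightarrow> 'z list" where
  "Zn = (\<lambda>(xs, ys, zs, f1, f2, kA, kB). zs)"

definition F12 :: "('x, 'y, 'z) outcome \<Rightarrow> nat \<times> nat" where
  "F12 = (\<lambda>(xs, ys, zs, f1, f2, kA, kB). (f1, f2))"

definition KA :: "('x, 'y, 'z) outcome \<Rightarrow> nat" where
  "KA = (\<lambda>(xs, ys, zs, f1, f2, kA, kB). kA)"

definition KB :: "('x, 'y, 'z) outcome \<Rightarrow> nat" where
  "KB = (\<lambda>(xs, ys, zs, f1, f2, kA, kB). kB)"

definition ni_code ::
  "('x::finite \<times> 'y::finite \<times> 'z::finite) pmf \<Rightarrow> nat \<Rightarrow> real \<Rightarrow> real \<Rightarrow> ('x, 'y) ni_scheme \<Rightarrow> bool"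
where
  "ni_code P n R \<delta> c \<longleftrightarrow>
     n \<ge> 1 \<and> finite_scheme c \<and>
     R = ent (ni_law P n c) KA / n \<and>
     measure_pmf.prob (ni_law P n c) {w. KA w = KB w} \<ge> 1 - \<delta> \<and>
     R \<ge> log 2 (card (alph_K c)) / n - \<delta> \<and>
     mut_info (ni_law P n c) KA (\<lambda>w. (Zn w, F12 w)) / n \<le> \<delta>"

definition ni_achievable :: "('x::finite \<times> 'y::finite \<times> 'z::finite) pmf \<Rightarrow> real \<Rightarrow> bool" where
  "ni_achievable P R \<longleftrightarrow> (\<forall>\<delta>>0. \<exists>n c. ni_code P n R \<delta> c)"

text \<open>
  The real supremum is meaningful here: rate 0 is achievable (constant key), and by Fano's
  inequality achievable rates are bounded.
\<close>

definition S_ni :: "('x::finite \<times> 'y::finite \<times> 'z::finite) pmf \<Rightarrow> real" where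
  "S_ni P = Sup {R. ni_achievable P R}"

text \<open>
  In contrast, the constraint below can be unsatisfiable for large \<open>\<Delta>\<close>, so this supremum is taken
  in the extended reals, where the supremum of the empty set is \<open>-\<infinity>\<close>.
\<close>

definition S_ni_constrained ::
  "('x::finite \<times> 'y::finite \<times> 'z::finite) pmf \<Rightarrow> real \<Rightarrow> ereal" where
  "S_ni_constrained P \<Delta> = (SUP R \<in> {R. \<exists>n Rk \<delta> c L.
       (\<forall>k. ni_code P (n k) (Rk k) (\<delta> k) (c k)) \<and>
       filterlim n at_top sequentially \<and> \<delta> \<longlonglongrightarrow> 0 \<and> Rk \<longlonglongrightarrow> R \<and>
       (\<lambda>k. cond_ent (ni_law P (n k) (c k)) Zn F12 / n k) \<longlonglongrightarrow> L \<and> L \<ge> \<Delta>}. ereal R)"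

section \<open>The thresholds\<close>

text \<open>
  Auxiliary variables take values in a finite set of natural numbers; \<open>Q\<close> is the joint law of
  \<open>(U, X, Y, Z)\<close>. The infima are over nonempty sets bounded below, and are minima: by
  Caratheodory's theorem bounded cardinality of \<open>U\<close> suffices, and the objective is continuous.
\<close>

definition Delta1 :: "('x::finite \<times> 'y::finite \<times> 'z::finite) pmf \<Rightarrow> real" where
  "Delta1 P = Inf {cond_ent Q (\<lambda>(u, x, y, z). z) (\<lambda>(u, x, y, z). u)
                   - cond_ent Q (\<lambda>(u, x, y, z). y) (\<lambda>(u, x, y, z). u) | Q :: (nat \<times> 'x \<times> 'y \<times> 'z) pmf.
      finite (set_pmf Q) \<and> map_pmf snd Q = P \<and>
      markov_chain Q (\<lambda>(u, x, y, z). u) (\<lambda>(u, x, y, z). x) (\<lambda>(u, x, y, z). (y, z))}"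

definition Delta2 :: "('x::finite \<times> 'y::finite \<times> 'z::finite) pmf \<Rightarrow> real" where
  "Delta2 P = Inf {cond_ent Q (\<lambda>(v, x, y, z). z) (\<lambda>(v, x, y, z). v)
                   - cond_ent Q (\<lambda>(v, x, y, z). x) (\<lambda>(v, x, y, z). v) | Q :: (nat \<times> 'x \<times> 'y \<times> 'z) pmf.
      finite (set_pmf Q) \<and> map_pmf snd Q = P \<and>
      markov_chain Q (\<lambda>(v, x, y, z). v) (\<lambda>(v, x, y, z). y) (\<lambda>(v, x, y, z). (x, z))}"

text \<open>
  Binary variables are encoded as booleans (\<open>False\<close> is 0, \<open>True\<close> is 1), so that the sum modulo 2
  is inequality.
\<close>

definition xor_source :: "(bool \<times> bool) pmf \<Rightarrow> (bool \<times> bool \<times> bool) pmf" where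
  "xor_source PXY = map_pmf (\<lambda>(x, y). (x, y, x \<noteq> y)) PXY"

end

theory Submission
  imports Defs "HOL-Real_Asymp.Real_Asymp"
begin

text \<open>
  Write \<open>F = (F\<^sub>1, F\<^sub>2)\<close>. For every code, a telescoping sum over the time index gives
  \<open>H(Z\<^sup>n|F\<^sub>1) - H(Y\<^sup>n|F\<^sub>1) \<ge> n \<Delta>\<^sub>1\<close>, and revealing \<open>F\<^sub>2\<close>, which depends on \<open>Y\<^sup>n\<close> only,
  does not decrease the left-hand side. Since the key is nearly independent of \<open>F\<close> and nearly
  determined by \<open>(Y\<^sup>n, F)\<close>, Fano's inequality gives \<open>H(Y\<^sup>n|F) \<ge> n R - o(n)\<close>. By symmetry,
  \<open>H(Z\<^sup>n|F) \<ge> n (max \<Delta>\<^sub>1 \<Delta>\<^sub>2 + R) - o(n)\<close>. Let \<open>S\<close> be the unconstrained supremum. If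
  \<open>max \<Delta>\<^sub>1 \<Delta>\<^sub>2 + S \<le> 0\<close>, the constraint is void
  because entropies are nonnegative; otherwise it holds with strict slack for rates \<open>R\<close> close to
  \<open>S\<close>, because \<open>(max \<Delta>\<^sub>1 \<Delta>\<^sub>2 + S) / 2 < max \<Delta>\<^sub>1 \<Delta>\<^sub>2 + S\<close>.

  Two gaps between the definitions have to be bridged: achievability does not force the
  blocklength to grow, which is mended by repeating a code, and it asks for an exact rate where
  the constrained supremum only has a limit, which is mended by compressing the key and erasing it
  according to a public coin.
\<close>

section \<open>Entropy calculus\<close>

text \<open>Both sides are expectations of \<open>g\<close>, taken after and before pushing
  \<open>p\<close> forward along \<open>A\<close>. Writing all entropies as sums over the one sample
  space allows those of different variables to be combined term by term.\<close>

lemma sum_map_pmf: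
  fixes g :: "'a \<Rightarrow> real"
  assumes "finite (set_pmf p)"
  shows "(\<Sum>a\<in>A ` set_pmf p. pmf (map_pmf A p) a * g a) = (\<Sum>w\<in>set_pmf p. pmf p w * g (A w))"
proof -
  have "(\<Sum>a\<in>A ` set_pmf p. pmf (map_pmf A p) a * g a) = measure_pmf.expectation (map_pmf A p) g"
    by (subst integral_measure_pmf_real[of "A ` set_pmf p"]) (use assms in \<open>auto simp: mult.commute\<close>)
  also have "\<dots> = measure_pmf.expectation p (\<lambda>w. g (A w))"
    by simp
  also have "\<dots> = (\<Sum>w\<in>set_pmf p. pmf p w * g (A w))"
    by (subst integral_measure_pmf_real[of "set_pmf p"]) (use assms in \<open>auto simp: mult.commute\<close>)
  finally show ?thesis .
qed

lemma pmf_map_pos: "w \<in> set_pmf p \<Longrightarrow> 0 < pmf (map_pmf A p) (A w)"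
  by (simp add: pmf_positive)

lemma ent_eq_expectation:
  assumes "finite (set_pmf p)"
  shows "ent p A = - (\<Sum>w\<in>set_pmf p. pmf p w * log 2 (pmf (map_pmf A p) (A w)))"
  using sum_map_pmf[OF assms, of A "\<lambda>a. log 2 (pmf (map_pmf A p) a)"]
  by (simp add: ent_eq_sum assms)

lemma cond_ent_eq:
  assumes "finite (set_pmf p)"
  shows "cond_ent p A B = ent p (\<lambda>w. (A w, B w)) - ent p B"
proof -
  let ?C = "\<lambda>w. (A w, B w)"
  have "cond_ent p A B = - (\<Sum>w\<in>set_pmf p. pmf p w *
      log 2 (pmf (map_pmf ?C p) (A w, B w) / pmf (map_pmf B p) (B w)))"
    using sum_map_pmf[OF assms, of ?C "\<lambda>(a, b). log 2 (pmf (map_pmf ?C p) (a, b) / pmf (map_pmf B p) b)"]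
    by (simp add: cond_ent_eq_sum assms case_prod_beta)
  also have "\<dots> = - (\<Sum>w\<in>set_pmf p. pmf p w *
      (log 2 (pmf (map_pmf ?C p) (A w, B w)) - log 2 (pmf (map_pmf B p) (B w))))"
    using pmf_map_pos[of _ p ?C] pmf_map_pos[of _ p B]
    by (intro arg_cong[of _ _ uminus] sum.cong refl) (simp add: log_divide less_imp_neq[symmetric])
  finally show ?thesis
    by (simp add: ent_eq_expectation assms right_diff_distrib sum_subtractf)
qed

lemma mut_info_eq:
  assumes "finite (set_pmf p)"
  shows "mut_info p A B = ent p A + ent p B - ent p (\<lambda>w. (A w, B w))"
proof -
  let ?C = "\<lambda>w. (A w, B w)"
  have "mut_info p A B = (\<Sum>w\<in>set_pmf p. pmf p w *
      log 2 (pmf (map_pmf ?C p) (A w, B w) / (pmf (map_pmf A p) (A w) * pmf (map_pmf B p) (B w))))"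
    using sum_map_pmf[OF assms, of ?C "\<lambda>(a, b). log 2 (pmf (map_pmf ?C p) (a, b) /
      (pmf (map_pmf A p) a * pmf (map_pmf B p) b))"]
    by (simp add: mut_info_eq_sum assms case_prod_beta)
  also have "\<dots> = (\<Sum>w\<in>set_pmf p. pmf p w *
      (log 2 (pmf (map_pmf ?C p) (A w, B w)) - log 2 (pmf (map_pmf A p) (A w))
        - log 2 (pmf (map_pmf B p) (B w))))"
    using pmf_map_pos[of _ p ?C] pmf_map_pos[of _ p B] pmf_map_pos[of _ p A]
    by (intro sum.cong refl) (simp add: log_divide log_mult less_imp_neq[symmetric])
  finally show ?thesis
    by (simp add: ent_eq_expectation assms right_diff_distrib sum_subtractf)
qed

lemma ent_map_pmf:
  assumes "finite (set_pmf p)"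
  shows "ent (map_pmf f p) A = ent p (\<lambda>w. A (f w))"
  using assms by (simp add: ent_eq_sum map_pmf_comp image_image)

section \<open>Gibbs' inequality and its consequences\<close>

text \<open>Nonnegativity of relative entropy, from \<open>ln t \<le> t - 1\<close> at the ratio of
  \<open>r\<close> to the true law. The comparison weights may be left unnormalized, as total mass
  at most one on the values of \<open>A\<close> suffices.\<close>

lemma gibbs_inequality:
  assumes fin: "finite (set_pmf p)"
    and pos: "\<And>w. w \<in> set_pmf p \<Longrightarrow> 0 < r (A w)"
    and le1: "(\<Sum>a\<in>A ` set_pmf p. r a) \<le> 1"
  shows "ent p A \<le> - (\<Sum>w\<in>set_pmf p. pmf p w * log 2 (r (A w)))"
proof -
  let ?q = "pmf (map_pmf A p)"
  have "(\<Sum>w\<in>set_pmf p. pmf p w * log 2 (r (A w))) - (\<Sum>w\<in>set_pmf p. pmf p w * log 2 (?q (A w)))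
      = (\<Sum>w\<in>set_pmf p. pmf p w * (log 2 (r (A w)) - log 2 (?q (A w))))"
    by (simp add: right_diff_distrib sum_subtractf)
  also have "\<dots> \<le> (\<Sum>w\<in>set_pmf p. pmf p w * ((r (A w) / ?q (A w) - 1) / ln 2))"
  proof (intro sum_mono mult_left_mono)
    fix w assume w: "w \<in> set_pmf p"
    have "log 2 (r (A w)) - log 2 (?q (A w)) = ln (r (A w) / ?q (A w)) / ln 2"
      using pos[OF w] pmf_map_pos[OF w, of A] by (simp add: log_def ln_div diff_divide_distrib)
    also have "\<dots> \<le> (r (A w) / ?q (A w) - 1) / ln 2"
      using pos[OF w] pmf_map_pos[OF w, of A] by (intro divide_right_mono ln_le_minus_one) auto
    finally show "log 2 (r (A w)) - log 2 (?q (A w)) \<le> (r (A w) / ?q (A w) - 1) / ln 2" .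
  qed simp
  also have "\<dots> = ((\<Sum>w\<in>set_pmf p. pmf p w * (r (A w) / ?q (A w))) - (\<Sum>w\<in>set_pmf p. pmf p w)) / ln 2"
    by (simp add: right_diff_distrib sum_subtractf sum_divide_distrib diff_divide_distrib)
  also have "(\<Sum>w\<in>set_pmf p. pmf p w * (r (A w) / ?q (A w))) = (\<Sum>a\<in>A ` set_pmf p. ?q a * (r a / ?q a))"
    by (rule sum_map_pmf[OF fin, of A "\<lambda>a. r a / ?q a", symmetric])
  also have "\<dots> = (\<Sum>a\<in>A ` set_pmf p. r a)"
    by (intro sum.cong refl) (auto simp: pmf_eq_0_set_pmf)
  also have "(\<Sum>w\<in>set_pmf p. pmf p w) = 1"
    using fin by (intro sum_pmf_eq_1) auto
  also have "((\<Sum>a\<in>A ` set_pmf p. r a) - 1) / ln 2 \<le> 0"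
    using le1 by (simp add: divide_nonpos_pos)
  finally show ?thesis by (simp add: ent_eq_expectation fin)
qed

lemma ent_nonneg:
  assumes "finite (set_pmf p)"
  shows "0 \<le> ent p A"
  unfolding ent_eq_expectation[OF assms] neg_0_le_iff_le
  using pmf_map_pos[of _ p A]
  by (intro sum_nonpos mult_nonneg_nonpos) (auto simp: pmf_le_1)

text \<open>Gibbs' inequality against the uniform weights on \<open>S\<close>.\<close>

lemma ent_le_log_card:
  assumes fin: "finite (set_pmf p)" and S: "finite S" "A ` set_pmf p \<subseteq> S"
  shows "ent p A \<le> log 2 (card S)"
proof -
  have "S \<noteq> {}" using S(2) set_pmf_not_empty[of p] by auto
  then have c: "card S > 0" using S(1) by (simp add: card_gt_0_iff)
  have "ent p A \<le> - (\<Sum>w\<in>set_pmf p. pmf p w * log 2 (1 / card S))"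
  proof (rule gibbs_inequality[OF fin])
    have "real (card (A ` set_pmf p)) \<le> real (card S)"
      using card_mono[OF S] by linarith
    then show "(\<Sum>a\<in>A ` set_pmf p. 1 / real (card S)) \<le> 1"
      using c by (simp add: divide_simps)
  qed (use c in simp)
  also have "\<dots> = - ((\<Sum>w\<in>set_pmf p. pmf p w) * log 2 (1 / card S))"
    by (simp add: sum_distrib_right)
  also have "(\<Sum>w\<in>set_pmf p. pmf p w) = 1"
    using fin by (intro sum_pmf_eq_1) auto
  finally show ?thesis using c by (simp add: log_divide)
qed

text \<open>Each fibre of \<open>B\<close> meets the support inside a fibre of \<open>A\<close>, so
  the observed value of \<open>A\<close> is pointwise at least as probable as that of
  \<open>B\<close>.\<close>

lemma ent_mono:
  assumes fin: "finite (set_pmf p)"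
    and det: "\<And>v w. v \<in> set_pmf p \<Longrightarrow> w \<in> set_pmf p \<Longrightarrow> B v = B w \<Longrightarrow> A v = A w"
  shows "ent p A \<le> ent p B"
  unfolding ent_eq_expectation[OF fin] neg_le_iff_le
proof (intro sum_mono mult_left_mono)
  fix w assume w: "w \<in> set_pmf p"
  have "measure (measure_pmf p) (B -` {B w}) = measure (measure_pmf p) (B -` {B w} \<inter> set_pmf p)"
    by (simp add: measure_Int_set_pmf)
  also have "\<dots> \<le> measure (measure_pmf p) (A -` {A w})"
  proof (rule measure_pmf.finite_measure_mono)
    show "B -` {B w} \<inter> set_pmf p \<subseteq> A -` {A w}"
      using det[OF _ w] by blast
  qed simp
  finally have "pmf (map_pmf B p) (B w) \<le> pmf (map_pmf A p) (A w)"
    by (simp add: pmf_map)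
  then show "log 2 (pmf (map_pmf B p) (B w)) \<le> log 2 (pmf (map_pmf A p) (A w))"
    using pmf_map_pos[OF w, of B] pmf_map_pos[OF w, of A] by (subst log_le_cancel_iff) auto
qed simp

text \<open>Monotonicity in both directions. This is how tuples are regrouped and injective
  encodings removed.\<close>

lemma ent_cong:
  assumes "finite (set_pmf p)"
    and "\<And>v w. v \<in> set_pmf p \<Longrightarrow> w \<in> set_pmf p \<Longrightarrow> B v = B w \<longleftrightarrow> A v = A w"
  shows "ent p A = ent p B"
  using ent_mono[OF assms(1), of B A] ent_mono[OF assms(1), of A B] assms(2) by (meson order_antisym)

lemma pmf_map_eq_sum:
  assumes fin: "finite (set_pmf p)"
  shows "(\<Sum>b\<in>B ` set_pmf p. pmf (map_pmf (\<lambda>w. (B w, C w)) p) (b, c)) = pmf (map_pmf C p) c"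
proof -
  have "(\<Sum>b\<in>B ` set_pmf p. pmf (map_pmf (\<lambda>w. (B w, C w)) p) (b, c))
      = (\<Sum>b\<in>B ` set_pmf p. measure (measure_pmf p) ((\<lambda>w. (B w, C w)) -` {(b, c)}))"
    by (simp add: pmf_map)
  also have "\<dots> = measure (measure_pmf p) (\<Union>b\<in>B ` set_pmf p. (\<lambda>w. (B w, C w)) -` {(b, c)})"
    by (rule measure_pmf.finite_measure_finite_Union[symmetric])
      (use fin in \<open>auto simp: disjoint_family_on_def\<close>)
  also have "\<dots> = measure (measure_pmf p) (C -` {c})"
    by (rule measure_prob_cong_0) (auto simp: pmf_eq_0_set_pmf)
  finally show ?thesis by (simp add: pmf_map)
qed

text \<open>Gibbs' inequality against the law under which \<open>A\<close> and \<open>B\<close> are independent given \<open>C\<close>.\<close>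

lemma ent_submodular:
  assumes fin: "finite (set_pmf p)"
  shows "ent p (\<lambda>w. (A w, B w, C w)) + ent p C \<le> ent p (\<lambda>w. (A w, C w)) + ent p (\<lambda>w. (B w, C w))"
proof -
  let ?S = "set_pmf p"
  let ?AC = "pmf (map_pmf (\<lambda>w. (A w, C w)) p)" and ?BC = "pmf (map_pmf (\<lambda>w. (B w, C w)) p)"
  let ?C = "pmf (map_pmf C p)"
  define r where "r = (\<lambda>(a, b, c). ?AC (a, c) * ?BC (b, c) / ?C c)"
  have pos: "0 < ?AC (A w, C w)" "0 < ?BC (B w, C w)" "0 < ?C (C w)" if "w \<in> ?S" for w
    using pmf_map_pos[OF that, of "\<lambda>w. (A w, C w)"] pmf_map_pos[OF that, of "\<lambda>w. (B w, C w)"]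
      pmf_map_pos[OF that, of C] by auto
  have "ent p (\<lambda>w. (A w, B w, C w)) \<le> - (\<Sum>w\<in>?S. pmf p w * log 2 (r (A w, B w, C w)))"
  proof (rule gibbs_inequality[OF fin])
    show "0 < r (A w, B w, C w)" if "w \<in> ?S" for w
      using pos[OF that] by (simp add: r_def)
    \<comment> \<open>Enlarging the index set to all \<open>(a, c)\<close> in the support of
      \<open>(A, C)\<close> combined with all values \<open>b\<close> lets \<open>b\<close> be
      summed out: \<open>?BC\<close> sums to \<open>?C\<close>, which cancels, and
      \<open>?AC\<close> has total mass one.\<close>
    have "(\<Sum>x\<in>(\<lambda>w. (A w, B w, C w)) ` ?S. r x)
        \<le> (\<Sum>x\<in>(\<lambda>((a, c), b). (a, b, c)) ` (((\<lambda>w. (A w, C w)) ` ?S) \<times> (B ` ?S)). r x)"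
      by (rule sum_mono2) (use fin in \<open>force simp: r_def\<close>)+
    also have "\<dots> = (\<Sum>x\<in>((\<lambda>w. (A w, C w)) ` ?S) \<times> (B ` ?S). r (fst (fst x), snd x, snd (fst x)))"
      by (subst sum.reindex) (auto simp: inj_on_def case_prod_beta)
    also have "\<dots> = (\<Sum>x\<in>((\<lambda>w. (A w, C w)) ` ?S). \<Sum>b\<in>B ` ?S. r (fst x, b, snd x))"
      by (simp add: sum.cartesian_product case_prod_beta)
    also have "\<dots> = (\<Sum>x\<in>((\<lambda>w. (A w, C w)) ` ?S). ?AC x)"
    proof (rule sum.cong[OF refl], clarify)
      fix w assume w: "w \<in> ?S"
      have "(\<Sum>b\<in>B ` ?S. r (fst (A w, C w), b, snd (A w, C w)))
          = ?AC (A w, C w) / ?C (C w) * (\<Sum>b\<in>B ` ?S. ?BC (b, C w))"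
        by (simp add: r_def sum_distrib_left)
      also have "\<dots> = ?AC (A w, C w)"
        using pos[OF w] by (simp add: pmf_map_eq_sum[OF fin])
      finally show "(\<Sum>b\<in>B ` ?S. r (fst (A w, C w), b, snd (A w, C w))) = ?AC (A w, C w)" .
    qed
    also have "\<dots> = 1" using fin by (intro sum_pmf_eq_1) auto
    finally show "(\<Sum>x\<in>(\<lambda>w. (A w, B w, C w)) ` ?S. r x) \<le> 1" .
  qed
  also have "\<dots> = - (\<Sum>w\<in>?S. pmf p w * (log 2 (?AC (A w, C w)) + log 2 (?BC (B w, C w)) - log 2 (?C (C w))))"
    using pos by (intro arg_cong[of _ _ uminus] sum.cong refl)
      (simp add: r_def log_divide log_mult less_imp_neq[symmetric])
  also have "\<dots> = ent p (\<lambda>w. (A w, C w)) + ent p (\<lambda>w. (B w, C w)) - ent p C"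
    unfolding ent_eq_expectation[OF fin]
    by (simp only: distrib_left right_diff_distrib sum_subtractf sum.distrib)
  finally show ?thesis by linarith
qed

lemma ent_const:
  assumes "finite (set_pmf p)"
  shows "ent p (\<lambda>_. c) = 0"
proof (rule antisym)
  show "ent p (\<lambda>_. c) \<le> 0"
    using ent_le_log_card[OF assms, of "{c}" "\<lambda>_. c"] by (simp add: image_subset_iff)
qed (rule ent_nonneg[OF assms])

text \<open>Submodularity over a constant third variable.\<close>

lemma ent_subadditive:
  assumes fin: "finite (set_pmf p)"
  shows "ent p (\<lambda>w. (A w, B w)) \<le> ent p A + ent p B"
proof -
  have "ent p (\<lambda>w. (A w, B w, 0::nat)) + ent p (\<lambda>_. 0::nat)
      \<le> ent p (\<lambda>w. (A w, 0::nat)) + ent p (\<lambda>w. (B w, 0::nat))"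
    by (rule ent_submodular[OF fin])
  moreover have "ent p (\<lambda>w. (A w, B w, 0::nat)) = ent p (\<lambda>w. (A w, B w))"
    by (rule ent_cong[OF fin]) simp
  moreover have "ent p (\<lambda>w. (A w, 0::nat)) = ent p A"
    by (rule ent_cong[OF fin]) simp
  moreover have "ent p (\<lambda>w. (B w, 0::nat)) = ent p B"
    by (rule ent_cong[OF fin]) simp
  ultimately show ?thesis using ent_const[OF fin, of "0::nat"] by linarith
qed

text \<open>Gibbs' inequality, where the comparison weight is the law of \<open>B\<close> times an
  equal mixture of the point mass at \<open>b\<close> and the uniform weights on \<open>S\<close>. A
  correct guess costs at most one bit, a wrong one \<open>1 + log 2 (card S)\<close> bits. The fixed
  mixture yields the constant 1 in place of the binary entropy of the error probability.\<close>

lemma fano_inequality: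
  fixes A B :: "'w \<Rightarrow> 'a::countable"
  assumes fin: "finite (set_pmf p)" and S: "finite S" "A ` set_pmf p \<subseteq> S"
  shows "ent p (\<lambda>w. (A w, B w)) - ent p B \<le> 1 + measure_pmf.prob p {w. A w \<noteq> B w} * log 2 (card S)"
proof -
  let ?S = "set_pmf p" and ?B = "pmf (map_pmf B p)"
  have "S \<noteq> {}" using S(2) set_pmf_not_empty[of p] by auto
  then have c: "card S > 0" using S(1) by (simp add: card_gt_0_iff)
  define r where "r = (\<lambda>(a, b). ?B b * ((of_bool (a = b) + 1 / card S) / 2))"
  have B: "0 < ?B (B w)" if "w \<in> ?S" for w
    using pmf_map_pos[OF that] .
  have "ent p (\<lambda>w. (A w, B w)) \<le> - (\<Sum>w\<in>?S. pmf p w * log 2 (r (A w, B w)))"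
  proof (rule gibbs_inequality[OF fin])
    show "0 < r (A w, B w)" if "w \<in> ?S" for w
      using B[OF that] c unfolding r_def prod.case by (intro mult_pos_pos divide_pos_pos add_nonneg_pos) auto
    have "(\<Sum>x\<in>(\<lambda>w. (A w, B w)) ` ?S. r x) \<le> (\<Sum>x\<in>S \<times> B ` ?S. r x)"
      by (rule sum_mono2) (use fin S in \<open>auto simp: r_def\<close>)
    also have "\<dots> = (\<Sum>b\<in>B ` ?S. \<Sum>a\<in>S. r (a, b))"
      by (subst sum.swap) (simp add: sum.cartesian_product)
    \<comment> \<open>\<open>B\<close> may take values outside \<open>S\<close>; for those the point
      mass is lost and the mixture has mass one half only.\<close>
    also have "\<dots> = (\<Sum>b\<in>B ` ?S. ?B b * ((of_bool (b \<in> S) + 1) / 2))"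
    proof (intro sum.cong refl)
      fix b
      have "(\<Sum>a\<in>S. r (a, b)) = ?B b * ((\<Sum>a\<in>S. of_bool (a = b) + 1 / real (card S)) / 2)"
        by (simp add: r_def sum_distrib_left sum_divide_distrib)
      also have "(\<Sum>a\<in>S. of_bool (a = b) + 1 / real (card S)) = of_bool (b \<in> S) + 1"
        using c S(1) \<open>S \<noteq> {}\<close> by (simp add: sum.distrib of_bool_def sum.delta)
      finally show "(\<Sum>a\<in>S. r (a, b)) = ?B b * ((of_bool (b \<in> S) + 1) / 2)" .
    qed
    also have "\<dots> \<le> (\<Sum>b\<in>B ` ?S. ?B b)"
      by (intro sum_mono) (auto intro: mult_left_le)
    also have "\<dots> = 1" using fin by (intro sum_pmf_eq_1) auto
    finally show "(\<Sum>x\<in>(\<lambda>w. (A w, B w)) ` ?S. r x) \<le> 1" .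
  qed
  also have "\<dots> \<le> - (\<Sum>w\<in>?S. pmf p w * (log 2 (?B (B w)) - 1 - of_bool (A w \<noteq> B w) * log 2 (card S)))"
    unfolding neg_le_iff_le
  proof (intro sum_mono mult_left_mono)
    fix w assume w: "w \<in> ?S"
    have "log 2 (?B (B w) * ((of_bool (A w = B w) + 1 / card S) / 2))
       = log 2 (?B (B w)) + log 2 (of_bool (A w = B w) + 1 / card S) - 1"
    proof -
      have "0 < of_bool (A w = B w) + 1 / real (card S)" using c by (intro add_nonneg_pos) auto
      then show ?thesis using B[OF w] by (simp add: log_divide log_mult less_imp_neq[symmetric])
    qed
    moreover have "log 2 (of_bool (A w = B w) + 1 / card S) \<ge> - of_bool (A w \<noteq> B w) * log 2 (card S)"
      using c by (cases "A w = B w") (simp_all add: log_divide zero_le_log_cancel_iff add_pos_nonneg)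
    ultimately show "log 2 (?B (B w)) - 1 - of_bool (A w \<noteq> B w) * log 2 (card S) \<le> log 2 (r (A w, B w))"
      by (simp add: r_def)
  qed simp
  also have "\<dots> = ent p B + (\<Sum>w\<in>?S. pmf p w) + (\<Sum>w\<in>?S. pmf p w * of_bool (A w \<noteq> B w)) * log 2 (card S)"
    by (simp add: ent_eq_expectation[OF fin] right_diff_distrib sum_subtractf sum_distrib_right mult.assoc)
  also have "(\<Sum>w\<in>?S. pmf p w) = 1" using fin by (intro sum_pmf_eq_1) auto
  also have "(\<Sum>w\<in>?S. pmf p w * of_bool (A w \<noteq> B w)) = measure_pmf.prob p {w. A w \<noteq> B w}"
  proof -
    have "measure_pmf.prob p {w. A w \<noteq> B w} = measure_pmf.prob p ({w. A w \<noteq> B w} \<inter> ?S)"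
      by (simp add: measure_Int_set_pmf)
    also have "\<dots> = (\<Sum>w\<in>{w. A w \<noteq> B w} \<inter> ?S. pmf p w)"
      using fin by (simp add: measure_measure_pmf_finite)
    also have "\<dots> = (\<Sum>w\<in>?S. pmf p w * of_bool (A w \<noteq> B w))"
      using fin by (intro sum.mono_neutral_cong_left) auto
    finally show ?thesis ..
  qed
  finally show ?thesis by simp
qed

section \<open>Stochastic kernels and conditional independence\<close>

text \<open>Conditional independence is expressed by factoring a law in this form with a kernel that
  sees \<open>w\<close> only through some \<open>g w\<close>.\<close>

definition joint_pmf :: "'a pmf \<Rightarrow> ('a \<Rightarrow> 'b pmf) \<Rightarrow> ('a \<times> 'b) pmf" where
  "joint_pmf p k = p \<bind> (\<lambda>w. map_pmf (Pair w) (k w))"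

lemma set_joint_pmf [simp]: "set_pmf (joint_pmf p k) = Sigma (set_pmf p) (\<lambda>w. set_pmf (k w))"
  by (auto simp: joint_pmf_def)

lemma pmf_joint_pmf: "pmf (joint_pmf p k) (w, a) = pmf p w * pmf (k w) a"
proof -
  have "pmf (joint_pmf p k) (w, a) = measure_pmf.expectation p (\<lambda>v. pmf (map_pmf (Pair v) (k v)) (w, a))"
    by (simp add: joint_pmf_def pmf_bind)
  also have "\<dots> = measure_pmf.expectation p (\<lambda>v. indicator {w} v * pmf (k w) a)"
  proof (rule Bochner_Integration.integral_cong[OF refl])
    fix v
    show "pmf (map_pmf (Pair v) (k v)) (w, a) = indicator {w} v * pmf (k w) a"
      by (auto simp: indicator_def pmf_map_inj' inj_on_def pmf_eq_0_set_pmf)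
  qed
  also have "\<dots> = pmf p w * pmf (k w) a"
    by (simp add: measure_pmf_single)
  finally show ?thesis .
qed

lemma map_fst_joint_pmf: "map_pmf fst (joint_pmf p k) = p"
  by (simp add: joint_pmf_def map_bind_pmf map_pmf_comp bind_return_pmf')

text \<open>The last term does not involve \<open>\<phi>\<close>: this is how conditional independence of \<open>a\<close> and
  \<open>\<phi> w\<close> given \<open>g w\<close> enters the entropy calculus.\<close>

lemma ent_kernel:
  fixes k :: "'c \<Rightarrow> 'a::countable pmf"
  assumes fin: "finite (set_pmf p)" and fink: "\<And>w. w \<in> set_pmf p \<Longrightarrow> finite (set_pmf (k (g w)))"
    and det: "\<And>v w. v \<in> set_pmf p \<Longrightarrow> w \<in> set_pmf p \<Longrightarrow> \<phi> v = \<phi> w \<Longrightarrow> g v = g w"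
  shows "ent (joint_pmf p (\<lambda>w. k (g w))) (\<lambda>(w, a). (\<phi> w, a))
    = ent p \<phi> + (\<Sum>w\<in>set_pmf p. pmf p w * ent (k (g w)) (\<lambda>a. a))"
proof -
  let ?q = "joint_pmf p (\<lambda>w. k (g w))"
  let ?S = "set_pmf p" and ?K = "\<lambda>w. set_pmf (k (g w))"
  have set: "set_pmf ?q = Sigma ?S ?K" by simp
  have finq: "finite (set_pmf ?q)" unfolding set using fin fink by auto
  have pq: "pmf ?q (w, a) = pmf p w * pmf (k (g w)) a" for w a
    by (rule pmf_joint_pmf)
  have pqm: "pmf (map_pmf (\<lambda>(w, a). (\<phi> w, a)) ?q) (\<phi> w, a) = pmf (map_pmf \<phi> p) (\<phi> w) * pmf (k (g w)) a"
    if w: "w \<in> ?S" for w a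
  proof -
    have "pmf (map_pmf (\<lambda>(w, a). (\<phi> w, a)) ?q) (\<phi> w, a)
       = measure ?q ((\<lambda>(w, a). (\<phi> w, a)) -` {(\<phi> w, a)} \<inter> set_pmf ?q)"
      by (simp add: pmf_map measure_Int_set_pmf del: set_joint_pmf)
    also have "\<dots> = measure ?q (((\<phi> -` {\<phi> w} \<inter> ?S) \<times> {a}) \<inter> set_pmf ?q)"
      by (rule arg_cong[of _ _ "measure ?q"]) auto
    also have "\<dots> = measure ?q ((\<phi> -` {\<phi> w} \<inter> ?S) \<times> {a})"
      by (simp add: measure_Int_set_pmf del: set_joint_pmf)
    also have "\<dots> = (\<Sum>v\<in>\<phi> -` {\<phi> w} \<inter> ?S. pmf p v * pmf (k (g v)) a)"
      using fin by (subst measure_measure_pmf_finite) (simp_all add: pq sum.cartesian_product' del: set_joint_pmf)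
    \<comment> \<open>\<open>\<phi>\<close> determines \<open>g\<close> on the support, so the
      kernel is constant on the fibre and factors out.\<close>
    also have "\<dots> = (\<Sum>v\<in>\<phi> -` {\<phi> w} \<inter> ?S. pmf p v) * pmf (k (g w)) a"
      unfolding sum_distrib_right
    proof (intro sum.cong refl)
      fix v assume "v \<in> \<phi> -` {\<phi> w} \<inter> ?S"
      then have "g v = g w" using det[of v w] w by blast
      then show "pmf p v * pmf (k (g v)) a = pmf p v * pmf (k (g w)) a" by simp
    qed
    also have "(\<Sum>v\<in>\<phi> -` {\<phi> w} \<inter> ?S. pmf p v) = measure p (\<phi> -` {\<phi> w} \<inter> ?S)"
      using fin by (subst measure_measure_pmf_finite) auto
    finally show ?thesis by (simp add: pmf_map measure_Int_set_pmf del: set_joint_pmf)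
  qed
  have "ent ?q (\<lambda>(w, a). (\<phi> w, a)) = - (\<Sum>w\<in>?S. \<Sum>a\<in>?K w. pmf p w * pmf (k (g w)) a *
      log 2 (pmf (map_pmf \<phi> p) (\<phi> w) * pmf (k (g w)) a))"
    unfolding ent_eq_expectation[OF finq] unfolding set
    using fin fink by (subst sum.Sigma) (auto simp: pq pqm case_prod_beta intro!: sum.cong)
  also have "\<dots> = - (\<Sum>w\<in>?S. pmf p w * (log 2 (pmf (map_pmf \<phi> p) (\<phi> w)) - ent (k (g w)) (\<lambda>a. a)))"
  proof (intro arg_cong[of _ _ uminus] sum.cong refl)
    fix w assume w: "w \<in> ?S"
    have "(\<Sum>a\<in>?K w. pmf p w * pmf (k (g w)) a * log 2 (pmf (map_pmf \<phi> p) (\<phi> w) * pmf (k (g w)) a))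
      = (\<Sum>a\<in>?K w. pmf p w * (pmf (k (g w)) a * log 2 (pmf (map_pmf \<phi> p) (\<phi> w))
           + pmf (k (g w)) a * log 2 (pmf (k (g w)) a)))"
      using pmf_map_pos[OF w, of \<phi>]
      by (intro sum.cong refl) (simp add: w log_mult pmf_positive algebra_simps pmf_eq_0_set_pmf)
    also have "\<dots> = pmf p w * ((\<Sum>a\<in>?K w. pmf (k (g w)) a) * log 2 (pmf (map_pmf \<phi> p) (\<phi> w))
           + (\<Sum>a\<in>?K w. pmf (k (g w)) a * log 2 (pmf (k (g w)) a)))"
      by (simp add: sum_distrib_left sum_distrib_right sum.distrib distrib_left mult.assoc)
    also have "(\<Sum>a\<in>?K w. pmf (k (g w)) a) = 1" using fink[OF w] by (intro sum_pmf_eq_1) auto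
    finally show "(\<Sum>a\<in>?K w. pmf p w * pmf (k (g w)) a * log 2 (pmf (map_pmf \<phi> p) (\<phi> w) * pmf (k (g w)) a))
      = pmf p w * (log 2 (pmf (map_pmf \<phi> p) (\<phi> w)) - ent (k (g w)) (\<lambda>a. a))"
      using fink[OF w] by (simp add: ent_eq_expectation map_pmf_ident)
  qed
  finally show ?thesis
    by (simp add: ent_eq_expectation[OF fin] right_diff_distrib sum_subtractf)
qed

section \<open>Single-letterization\<close>

lemma length_replicate_pmf: "s \<in> set_pmf (replicate_pmf n p) \<Longrightarrow> length s = n"
  by (simp add: set_replicate_pmf)

lemma finite_set_replicate_pmf: "finite (set_pmf p) \<Longrightarrow> finite (set_pmf (replicate_pmf n p))"
  by (simp add: set_replicate_pmf lists_eq_set finite_lists_length_eq)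

lemma sum_diff_ge_telescoping:
  fixes G :: "nat \<Rightarrow> real"
  assumes "\<And>i. i < n \<Longrightarrow> d \<le> G (Suc i) - G i"
  shows "real n * d \<le> G n - G 0"
  using assms
proof (induction n)
  case (Suc n)
  have "real n * d \<le> G n - G 0" "d \<le> G (Suc n) - G n"
    using Suc.prems by (auto intro!: Suc.IH)
  then show ?case by (simp add: distrib_right)
qed simp

text \<open>With \<open>U\<^sub>i = (f, \<zeta>\<^sup>i, \<eta>\<^sub>i\<^sub>+\<^sub>1\<^sup>n)\<close> for the message \<open>f\<close>, both members of the difference
  are the ends of a telescoping sum of \<open>ent (f, \<zeta>\<^sup>i, \<eta>\<^sub>i\<^sup>n)\<close>.\<close>

lemma ent_diff_single_letter:
  fixes \<zeta> :: "'t \<Rightarrow> 'c::countable" and \<eta> :: "'t \<Rightarrow> 'b::countable" and e :: "'a list \<Rightarrow> nat pmf"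
  assumes fin: "finite (set_pmf P)" and fine: "\<And>xs. finite (set_pmf (e xs))"
    and d: "\<And>k Q. (\<And>a. finite (set_pmf (k a))) \<Longrightarrow> Q = map_pmf prod.swap (joint_pmf P (\<lambda>t. k (g t)))
      \<Longrightarrow> d \<le> cond_ent Q (\<lambda>(u::nat, t). \<zeta> t) fst - cond_ent Q (\<lambda>(u, t). \<eta> t) fst"
  shows "real n * d \<le> ent (joint_pmf (replicate_pmf n P) (\<lambda>s. e (map g s))) (\<lambda>(s, f). (map \<zeta> s, f))
    - ent (joint_pmf (replicate_pmf n P) (\<lambda>s. e (map g s))) (\<lambda>(s, f). (map \<eta> s, f))"
proof -
  let ?M = "joint_pmf (replicate_pmf n P) (\<lambda>s. e (map g s))"
  define G where "G i = ent ?M (\<lambda>(s, f). (f, map \<zeta> (take i s), map \<eta> (drop i s)))" for i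
  have finM: "finite (set_pmf ?M)"
    using fin fine by (auto intro!: finite_SigmaI finite_set_replicate_pmf)
  have len: "length (fst w) = n" if "w \<in> set_pmf ?M" for w
    using that by (auto dest: length_replicate_pmf)
  have step: "d \<le> G (Suc i) - G i" if i: "i < n" for i
  proof -
    let ?j = "n - Suc i"
    \<comment> \<open>The thresholds range over auxiliary variables with values in
      \<open>nat\<close>, hence the encoding of the triple.\<close>
    let ?u = "\<lambda>(s, f). to_nat (f, map \<zeta> (take i s), map \<eta> (drop (Suc i) s))"
    \<comment> \<open>The conditional law of the auxiliary variable when \<open>g\<close> of the
      letter at position \<open>i\<close> is \<open>a\<close>: the other letters are drawn afresh
      and the message is generated from the completed block. That the letter enters through
      \<open>g\<close> alone is the Markov condition.\<close>
    define k where "k a = do {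
        s1 \<leftarrow> replicate_pmf i P; s2 \<leftarrow> replicate_pmf ?j P; f \<leftarrow> e (map g s1 @ a # map g s2);
        return_pmf (to_nat (f, map \<zeta> s1, map \<eta> s2))}" for a
    have fink: "finite (set_pmf (k a))" for a
      using fin fine by (auto simp: k_def intro!: finite_set_replicate_pmf)
    define Q where "Q = map_pmf prod.swap (joint_pmf P (\<lambda>t. k (g t)))"
    have finQ: "finite (set_pmf Q)" using fin fink by (auto simp: Q_def)
    have rep: "replicate_pmf n P = do {
        s1 \<leftarrow> replicate_pmf i P; t \<leftarrow> P; s2 \<leftarrow> replicate_pmf ?j P; return_pmf (s1 @ t # s2)}"
      using replicate_pmf_distrib[of i "Suc ?j" P] i
      by (simp add: bind_assoc_pmf bind_return_pmf)
    have "map_pmf (\<lambda>w. (?u w, fst w ! i)) ?M = do {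
        s1 \<leftarrow> replicate_pmf i P; t \<leftarrow> P; s2 \<leftarrow> replicate_pmf ?j P; f \<leftarrow> e (map g (s1 @ t # s2));
        return_pmf (?u (s1 @ t # s2, f), (s1 @ t # s2) ! i)}"
      unfolding rep by (simp add: joint_pmf_def bind_assoc_pmf bind_return_pmf map_pmf_def)
    also have "\<dots> = do {
        s1 \<leftarrow> replicate_pmf i P; t \<leftarrow> P; s2 \<leftarrow> replicate_pmf ?j P; f \<leftarrow> e (map g s1 @ g t # map g s2);
        return_pmf (to_nat (f, map \<zeta> s1, map \<eta> s2), t)}"
      by (intro bind_pmf_cong refl) (auto dest!: length_replicate_pmf simp: nth_append)
    \<comment> \<open>Letters are independent, so the one at position \<open>i\<close> can be drawn
      first; what remains is the kernel \<open>k\<close>.\<close>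
    also have "\<dots> = do {
        t \<leftarrow> P; s1 \<leftarrow> replicate_pmf i P; s2 \<leftarrow> replicate_pmf ?j P; f \<leftarrow> e (map g s1 @ g t # map g s2);
        return_pmf (to_nat (f, map \<zeta> s1, map \<eta> s2), t)}"
      by (rule bind_commute_pmf)
    also have "\<dots> = Q"
      by (simp add: Q_def k_def joint_pmf_def map_pmf_def bind_assoc_pmf bind_return_pmf)
    finally have MQ: "map_pmf (\<lambda>w. (?u w, fst w ! i)) ?M = Q" .
    \<comment> \<open>\<open>G (Suc i)\<close> and \<open>G i\<close> share \<open>?u\<close>: the
      longer prefix adds \<open>\<zeta>\<close> of letter \<open>i\<close> to the former, the longer
      suffix adds \<open>\<eta>\<close> of the same letter to the latter.\<close>
    have "G (Suc i) = ent ?M (\<lambda>w. (\<zeta> (fst w ! i), ?u w))"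
      unfolding G_def using i len
      by (intro ent_cong[OF finM]) (auto simp: take_Suc_conv_app_nth dest!: len)
    also have "\<dots> = ent Q (\<lambda>w. (\<zeta> (snd w), fst w))"
      by (simp add: MQ[symmetric] ent_map_pmf[OF finM] del: set_joint_pmf)
    finally have 1: "G (Suc i) = ent Q (\<lambda>w. (\<zeta> (snd w), fst w))" .
    have "G i = ent ?M (\<lambda>w. (\<eta> (fst w ! i), ?u w))"
      unfolding G_def using i len
      by (intro ent_cong[OF finM]) (auto simp: Cons_nth_drop_Suc[symmetric] dest!: len)
    also have "\<dots> = ent Q (\<lambda>w. (\<eta> (snd w), fst w))"
      by (simp add: MQ[symmetric] ent_map_pmf[OF finM] del: set_joint_pmf)
    finally have 2: "G i = ent Q (\<lambda>w. (\<eta> (snd w), fst w))" .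
    show ?thesis
      using d[OF fink Q_def] unfolding 1 2 by (simp add: cond_ent_eq[OF finQ] case_prod_beta)
  qed
  \<comment> \<open>The suffix is empty at \<open>n\<close> and the prefix is empty at
    \<open>0\<close>.\<close>
  have "G n = ent ?M (\<lambda>(s, f). (map \<zeta> s, f))"
    unfolding G_def by (rule ent_cong[OF finM]) (auto dest!: length_replicate_pmf)
  moreover have "G 0 = ent ?M (\<lambda>(s, f). (map \<eta> s, f))"
    unfolding G_def by (rule ent_cong[OF finM]) (auto dest!: length_replicate_pmf)
  ultimately show ?thesis
    using sum_diff_ge_telescoping[of n d G] step by simp
qed

section \<open>Kernels as competitors in the thresholds\<close>

text \<open>Conditioning on \<open>g t = b\<close> freezes the kernel at \<open>k b\<close> and so
  leaves a product of \<open>k b\<close> with the conditioned \<open>P\<close>. The swap puts the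
  auxiliary variable first, as the thresholds expect it.\<close>

lemma markov_chain_joint_pmf:
  fixes k :: "'a \<Rightarrow> 'u pmf"
  shows "markov_chain (map_pmf prod.swap (joint_pmf P (\<lambda>t. k (g t)))) fst (\<lambda>(u, t). g t) (\<lambda>(u, t). h t)"
  unfolding markov_chain_def
proof
  let ?Q = "map_pmf prod.swap (joint_pmf P (\<lambda>t. k (g t)))"
  fix b assume "b \<in> (\<lambda>(u, t). g t) ` set_pmf ?Q"
  then have ne: "set_pmf ?Q \<inter> {w. (\<lambda>(u, t). g t) w = b} \<noteq> {}" "set_pmf P \<inter> {t. g t = b} \<noteq> {}"
    by auto
  have "measure ?Q {w. (\<lambda>(u, t). g t) w = b}
      = measure (map_pmf fst (joint_pmf P (\<lambda>t. k (g t)))) {t. g t = b}"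
    by (simp add: vimage_def case_prod_beta)
  then have m: "measure ?Q {w. (\<lambda>(u, t). g t) w = b} = measure P {t. g t = b}"
    by (simp add: map_fst_joint_pmf)
  have Q: "pmf ?Q (u, t) = pmf P t * pmf (k (g t)) u" for u t
    using pmf_map_inj'[of prod.swap "joint_pmf P (\<lambda>t. k (g t))" "(t, u)"] by (simp add: pmf_joint_pmf)
  have "cond_pmf ?Q {w. (\<lambda>(u, t). g t) w = b} = pair_pmf (k b) (cond_pmf P {t. g t = b})"
  proof (rule pmf_eqI, clarify)
    fix u t
    show "pmf (cond_pmf ?Q {w. (\<lambda>(u, t). g t) w = b}) (u, t)
      = pmf (pair_pmf (k b) (cond_pmf P {t. g t = b})) (u, t)"
      unfolding pmf_pair pmf_cond[OF ne(1)] pmf_cond[OF ne(2)] m Q by simp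
  qed
  moreover have "map_pmf (\<lambda>w. (fst w, (\<lambda>(u, t). h t) w)) (pair_pmf K C)
      = pair_pmf (map_pmf fst (pair_pmf K C)) (map_pmf (\<lambda>(u, t). h t) (pair_pmf K C))"
    for K :: "'u pmf" and C
  proof -
    have "map_pmf (\<lambda>w. h (snd w)) (pair_pmf K C) = map_pmf h (map_pmf snd (pair_pmf K C))"
      by (simp only: map_pmf_comp)
    then show ?thesis
      by (simp add: map_fst_pair_pmf map_snd_pair_pmf pair_map_pmf2 case_prod_beta' apfst_def apsnd_def map_prod_def)
  qed
  ultimately show "let q = cond_pmf ?Q {w. (\<lambda>(u, t). g t) w = b} in
      map_pmf (\<lambda>w. (fst w, (\<lambda>(u, t). h t) w)) q
        = pair_pmf (map_pmf fst q) (map_pmf (\<lambda>(u, t). h t) q)"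
    by simp
qed

text \<open>Makes the infima in the thresholds genuine lower bounds: the first conditional entropy
  is nonnegative and the second is at most the logarithm of its alphabet size.\<close>

lemma cond_ent_diff_bounded_below:
  fixes B :: "'w \<Rightarrow> 'b::finite"
  assumes fin: "finite (set_pmf Q)"
  shows "- log 2 CARD('b) \<le> cond_ent Q A U - cond_ent Q B U"
proof -
  have "ent Q U \<le> ent Q (\<lambda>w. (A w, U w))" by (rule ent_mono[OF fin]) simp
  moreover have "ent Q (\<lambda>w. (B w, U w)) \<le> ent Q B + ent Q U" by (rule ent_subadditive[OF fin])
  moreover have "ent Q B \<le> log 2 CARD('b)" by (rule ent_le_log_card[OF fin]) auto
  ultimately show ?thesis by (simp add: cond_ent_eq[OF fin])
qed

text \<open>A law obtained by drawing the auxiliary variable from a kernel that sees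
  \<open>x\<close> only is feasible in the infimum.\<close>

lemma Delta1_le:
  fixes P :: "('x::finite \<times> 'y::finite \<times> 'z::finite) pmf" and k :: "_ \<Rightarrow> nat pmf"
  assumes "\<And>a. finite (set_pmf (k a))" and Q: "Q = map_pmf prod.swap (joint_pmf P (\<lambda>t. k (fst t)))"
  shows "Delta1 P \<le> cond_ent Q (\<lambda>(u, t). snd (snd t)) fst - cond_ent Q (\<lambda>(u, t). fst (snd t)) fst"
  unfolding Delta1_def
proof (rule cInf_lower[OF CollectI])
  have *: "(\<lambda>(u, x, y, z). u) = fst" "(\<lambda>(u, x, y, z). x) = (\<lambda>(u, t). fst t)"
    "(\<lambda>(u, x, y, z). (y, z)) = (\<lambda>(u, t). snd t)"
    "(\<lambda>(u, x, y, z). z) = (\<lambda>(u, t). snd (snd t))" "(\<lambda>(u, x, y, z). y) = (\<lambda>(u, t). fst (snd t))"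
    by (auto simp: fun_eq_iff)
  have "finite (set_pmf Q)" using assms by auto
  moreover have "map_pmf snd Q = P" by (simp add: Q map_pmf_comp map_fst_joint_pmf)
  moreover have "markov_chain Q (\<lambda>(u, x, y, z). u) (\<lambda>(u, x, y, z). x) (\<lambda>(u, x, y, z). (y, z))"
    unfolding * Q by (rule markov_chain_joint_pmf)
  ultimately show "\<exists>Q' :: (nat \<times> 'x \<times> 'y \<times> 'z) pmf. cond_ent Q (\<lambda>(u, t). snd (snd t)) fst - cond_ent Q (\<lambda>(u, t). fst (snd t)) fst
      = cond_ent Q' (\<lambda>(u, x, y, z). z) (\<lambda>(u, x, y, z). u) - cond_ent Q' (\<lambda>(u, x, y, z). y) (\<lambda>(u, x, y, z). u)
      \<and> finite (set_pmf Q') \<and> map_pmf snd Q' = P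
      \<and> markov_chain Q' (\<lambda>(u, x, y, z). u) (\<lambda>(u, x, y, z). x) (\<lambda>(u, x, y, z). (y, z))"
    unfolding * by blast
qed (auto intro!: bdd_belowI cond_ent_diff_bounded_below)

lemma Delta2_le:
  fixes P :: "('x::finite \<times> 'y::finite \<times> 'z::finite) pmf" and k :: "_ \<Rightarrow> nat pmf"
  assumes "\<And>a. finite (set_pmf (k a))" and Q: "Q = map_pmf prod.swap (joint_pmf P (\<lambda>t. k (fst (snd t))))"
  shows "Delta2 P \<le> cond_ent Q (\<lambda>(v, t). snd (snd t)) fst - cond_ent Q (\<lambda>(v, t). fst t) fst"
  unfolding Delta2_def
proof (rule cInf_lower[OF CollectI])
  have *: "(\<lambda>(v, x, y, z). v) = fst" "(\<lambda>(v, x, y, z). y) = (\<lambda>(v, t). fst (snd t))"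
    "(\<lambda>(v, x, y, z). (x, z)) = (\<lambda>(v, t). (fst t, snd (snd t)))"
    "(\<lambda>(v, x, y, z). z) = (\<lambda>(v, t). snd (snd t))" "(\<lambda>(v, x, y, z). x) = (\<lambda>(v, t). fst t)"
    by (auto simp: fun_eq_iff)
  have "finite (set_pmf Q)" using assms by auto
  moreover have "map_pmf snd Q = P" by (simp add: Q map_pmf_comp map_fst_joint_pmf)
  moreover have "markov_chain Q (\<lambda>(v, x, y, z). v) (\<lambda>(v, x, y, z). y) (\<lambda>(v, x, y, z). (x, z))"
    unfolding * Q by (rule markov_chain_joint_pmf)
  ultimately show "\<exists>Q' :: (nat \<times> 'x \<times> 'y \<times> 'z) pmf. cond_ent Q (\<lambda>(v, t). snd (snd t)) fst - cond_ent Q (\<lambda>(v, t). fst t) fst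
      = cond_ent Q' (\<lambda>(v, x, y, z). z) (\<lambda>(v, x, y, z). v) - cond_ent Q' (\<lambda>(v, x, y, z). x) (\<lambda>(v, x, y, z). v)
      \<and> finite (set_pmf Q') \<and> map_pmf snd Q' = P
      \<and> markov_chain Q' (\<lambda>(v, x, y, z). v) (\<lambda>(v, x, y, z). y) (\<lambda>(v, x, y, z). (x, z))"
    unfolding * by blast
qed (auto intro!: bdd_belowI cond_ent_diff_bounded_below)

section \<open>The equivocation of a code\<close>

text \<open>The conditional entropy of \<open>A\<close> is the mean entropy of the kernel output,
  whatever else \<open>\<phi>\<close> reveals beyond \<open>g\<close>.\<close>

lemma ent_cond_kernel:
  fixes k :: "'c \<Rightarrow> 'a::countable pmf"
  assumes fin: "finite (set_pmf W)"
    and law: "map_pmf (\<lambda>w. (V w, A w)) W = joint_pmf (map_pmf V W) (\<lambda>v. k (g v))"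
    and det: "\<And>u v. \<phi> u = \<phi> v \<Longrightarrow> g u = g v"
  shows "ent W (\<lambda>w. (\<phi> (V w), A w)) - ent W (\<lambda>w. \<phi> (V w))
    = (\<Sum>v\<in>V ` set_pmf W. pmf (map_pmf V W) v * ent (k (g v)) (\<lambda>a. a))"
proof -
  let ?p = "map_pmf V W"
  let ?q = "joint_pmf ?p (\<lambda>v. k (g v))"
  have finp: "finite (set_pmf ?p)" using fin by simp
  have finq: "finite (set_pmf ?q)" unfolding law[symmetric] using fin by simp
  have fink: "finite (set_pmf (k (g v)))" if "v \<in> set_pmf ?p" for v
  proof (rule finite_subset)
    show "set_pmf (k (g v)) \<subseteq> snd ` set_pmf ?q"
      using that by force
  qed (use finq in blast)
  have "ent W (\<lambda>w. (\<phi> (V w), A w)) = ent ?q (\<lambda>(v, a). (\<phi> v, a))"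
    unfolding law[symmetric] by (simp only: ent_map_pmf[OF fin] prod.case)
  also have "\<dots> = ent ?p \<phi> + (\<Sum>v\<in>set_pmf ?p. pmf ?p v * ent (k (g v)) (\<lambda>a. a))"
    by (rule ent_kernel[where g = g and k = k and \<phi> = \<phi>, OF finp fink det])
  finally show ?thesis by (simp add: ent_map_pmf[OF fin])
qed

text \<open>The mean kernel entropy is obtained both for \<open>\<phi>\<close> and for
  \<open>g\<close> itself, so conditioning on more than \<open>g (V w)\<close> does not lower the
  entropy of \<open>A\<close>.\<close>

lemma ent_markov:
  fixes k :: "'c::countable \<Rightarrow> 'a::countable pmf"
  assumes "finite (set_pmf W)"
    and "map_pmf (\<lambda>w. (V w, A w)) W = joint_pmf (map_pmf V W) (\<lambda>v. k (g v))"
    and "\<And>u v. \<phi> u = \<phi> v \<Longrightarrow> g u = g v"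
  shows "ent W (\<lambda>w. (\<phi> (V w), A w)) - ent W (\<lambda>w. \<phi> (V w))
    = ent W (\<lambda>w. (g (V w), A w)) - ent W (\<lambda>w. g (V w))"
  using ent_cond_kernel[where k = k and g = g and \<phi> = \<phi>, OF assms]
    ent_cond_kernel[where k = k and g = g and \<phi> = g, OF assms(1,2)] by simp

section \<open>Conditional independences within a code\<close>

definition Xn :: "('x, 'y, 'z) outcome \<Rightarrow> 'x list" where
  "Xn = (\<lambda>(xs, ys, zs, f1, f2, kA, kB). xs)"

definition Yn :: "('x, 'y, 'z) outcome \<Rightarrow> 'y list" where
  "Yn = (\<lambda>(xs, ys, zs, f1, f2, kA, kB). ys)"

definition F1 :: "('x, 'y, 'z) outcome \<Rightarrow> nat" where
  "F1 = (\<lambda>(xs, ys, zs, f1, f2, kA, kB). f1)"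

definition F2 :: "('x, 'y, 'z) outcome \<Rightarrow> nat" where
  "F2 = (\<lambda>(xs, ys, zs, f1, f2, kA, kB). f2)"

lemmas outcome_defs = Xn_def Yn_def Zn_def F1_def F2_def F12_def KA_def KB_def

lemma finite_scheme_finite_set:
  assumes "finite_scheme c"
  shows "finite (set_pmf (enc_A c xs))" "finite (set_pmf (enc_B c ys))"
    "finite (set_pmf (key_A c xs f1 f2))" "finite (set_pmf (key_B c ys f1 f2))"
  using assms unfolding finite_scheme_def by (meson finite_subset)+

lemma finite_set_ni_law:
  assumes "finite (set_pmf P)" "finite_scheme c"
  shows "finite (set_pmf (ni_law P n c))"
  using assms(1) finite_scheme_finite_set[OF assms(2)]
  by (auto simp: ni_law_def Let_def intro!: finite_set_replicate_pmf)

lemma length_ni_law: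
  "w \<in> set_pmf (ni_law P n c) \<Longrightarrow> length (Xn w) = n \<and> length (Yn w) = n \<and> length (Zn w) = n"
  by (auto simp: ni_law_def Let_def outcome_defs dest: length_replicate_pmf)

lemma KA_alph: "w \<in> set_pmf (ni_law P n c) \<Longrightarrow> finite_scheme c \<Longrightarrow> KA w \<in> alph_K c"
  by (auto simp: ni_law_def Let_def outcome_defs finite_scheme_def) blast

text \<open>The two parties use independent randomness, so the order of the two messages, and that
  of the two keys, is immaterial. In this order \<open>F1\<close> comes after \<open>F2\<close> and
  \<open>KA\<close> after \<open>KB\<close>, which exposes their kernels.\<close>

lemma ni_law_commute:
  "ni_law P n c = do {
     s \<leftarrow> replicate_pmf n P;
     f2 \<leftarrow> enc_B c (map (fst \<circ> snd) s);
     f1 \<leftarrow> enc_A c (map fst s);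
     kB \<leftarrow> key_B c (map (fst \<circ> snd) s) f1 f2;
     kA \<leftarrow> key_A c (map fst s) f1 f2;
     return_pmf (map fst s, map (fst \<circ> snd) s, map (snd \<circ> snd) s, f1, f2, kA, kB)
   }"
  unfolding ni_law_def Let_def
  by (rule bind_pmf_cong[OF refl], rule trans[OF bind_commute_pmf],
    (rule bind_pmf_cong[OF refl])+, rule bind_commute_pmf)

lemmas ni_law_bind_simps =
  joint_pmf_def map_pmf_def bind_assoc_pmf bind_return_pmf bind_pmf_const Let_def outcome_defs

text \<open>This and the next three factorizations are the Markov chains of the protocol, in the
  form that \<open>ent_markov\<close> requires: each message depends on its own source only, each
  key on its own source and the messages.\<close>

lemma ni_law_F2:
  "map_pmf (\<lambda>w. ((Xn w, Yn w, Zn w, F1 w), F2 w)) (ni_law P n c)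
    = joint_pmf (map_pmf (\<lambda>w. (Xn w, Yn w, Zn w, F1 w)) (ni_law P n c)) (\<lambda>(xs, ys, zs, f1). enc_B c ys)"
  by (simp add: ni_law_def ni_law_bind_simps)

lemma ni_law_F1:
  "map_pmf (\<lambda>w. ((Xn w, Yn w, Zn w, F2 w), F1 w)) (ni_law P n c)
    = joint_pmf (map_pmf (\<lambda>w. (Xn w, Yn w, Zn w, F2 w)) (ni_law P n c)) (\<lambda>(xs, ys, zs, f2). enc_A c xs)"
  by (simp add: ni_law_commute ni_law_bind_simps)

lemma ni_law_KB:
  "map_pmf (\<lambda>w. ((Xn w, Yn w, F1 w, F2 w, KA w), KB w)) (ni_law P n c)
    = joint_pmf (map_pmf (\<lambda>w. (Xn w, Yn w, F1 w, F2 w, KA w)) (ni_law P n c))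
        (\<lambda>(xs, ys, f1, f2, kA). key_B c ys f1 f2)"
  by (simp add: ni_law_def ni_law_bind_simps)

lemma ni_law_KA:
  "map_pmf (\<lambda>w. ((Xn w, Yn w, F1 w, F2 w, KB w), KA w)) (ni_law P n c)
    = joint_pmf (map_pmf (\<lambda>w. (Xn w, Yn w, F1 w, F2 w, KB w)) (ni_law P n c))
        (\<lambda>(xs, ys, f1, f2, kB). key_A c xs f1 f2)"
  by (simp add: ni_law_commute ni_law_bind_simps)

lemma ent_eq_if_map_pmf_eq:
  assumes fin: "finite (set_pmf p)" "finite (set_pmf q)" and eq: "map_pmf A p = map_pmf B q"
  shows "ent p A = ent q B"
proof -
  have "ent p A = ent (map_pmf A p) (\<lambda>x. x)" by (simp only: ent_map_pmf[OF fin(1)])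
  also have "\<dots> = ent q B" unfolding eq by (simp only: ent_map_pmf[OF fin(2)])
  finally show ?thesis .
qed

text \<open>The first message is generated from \<open>Xn\<close> alone, so the single-letter bound
  applies with \<open>g = fst\<close>. The entropies of pairs stand for conditional ones, as the
  entropy of \<open>F1\<close> cancels in the difference.\<close>

lemma ent_diff_ge_Delta1:
  fixes P :: "('x::finite \<times> 'y::finite \<times> 'z::finite) pmf"
  assumes c: "finite_scheme c"
  shows "real n * Delta1 P \<le> ent (ni_law P n c) (\<lambda>w. (Zn w, F1 w)) - ent (ni_law P n c) (\<lambda>w. (Yn w, F1 w))"
proof -
  let ?W = "ni_law P n c"
  let ?M = "joint_pmf (replicate_pmf n P) (\<lambda>s. enc_A c (map fst s))"
  have fin: "finite (set_pmf ?W)" using c by (intro finite_set_ni_law) auto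
  note fine = finite_scheme_finite_set(1)[OF c]
  have finM: "finite (set_pmf ?M)"
    using fine by (auto intro!: finite_SigmaI finite_set_replicate_pmf)
  have "ent ?W (\<lambda>w. (Zn w, F1 w)) = ent ?M (\<lambda>(s, f). (map (\<lambda>t. snd (snd t)) s, f))"
    by (rule ent_eq_if_map_pmf_eq[OF fin finM]) (simp add: ni_law_def ni_law_bind_simps comp_def)
  moreover have "ent ?W (\<lambda>w. (Yn w, F1 w)) = ent ?M (\<lambda>(s, f). (map (\<lambda>t. fst (snd t)) s, f))"
    by (rule ent_eq_if_map_pmf_eq[OF fin finM]) (simp add: ni_law_def ni_law_bind_simps comp_def)
  moreover have "real n * Delta1 P \<le> ent ?M (\<lambda>(s, f). (map (\<lambda>t. snd (snd t)) s, f))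
      - ent ?M (\<lambda>(s, f). (map (\<lambda>t. fst (snd t)) s, f))"
    by (rule ent_diff_single_letter[where P = P and e = "enc_A c" and g = "fst" and d = "Delta1 P"
        and \<zeta> = "\<lambda>t. snd (snd t)" and \<eta> = "\<lambda>t. fst (snd t)" and n = n, OF finite fine Delta1_le])
  ultimately show ?thesis by simp
qed

lemma ent_diff_ge_Delta2:
  fixes P :: "('x::finite \<times> 'y::finite \<times> 'z::finite) pmf"
  assumes c: "finite_scheme c"
  shows "real n * Delta2 P \<le> ent (ni_law P n c) (\<lambda>w. (Zn w, F2 w)) - ent (ni_law P n c) (\<lambda>w. (Xn w, F2 w))"
proof -
  let ?W = "ni_law P n c"
  let ?M = "joint_pmf (replicate_pmf n P) (\<lambda>s. enc_B c (map (\<lambda>t. fst (snd t)) s))"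
  have fin: "finite (set_pmf ?W)" using c by (intro finite_set_ni_law) auto
  note fine = finite_scheme_finite_set(2)[OF c]
  have finM: "finite (set_pmf ?M)"
    using fine by (auto intro!: finite_SigmaI finite_set_replicate_pmf)
  have "ent ?W (\<lambda>w. (Zn w, F2 w)) = ent ?M (\<lambda>(s, f). (map (\<lambda>t. snd (snd t)) s, f))"
    by (rule ent_eq_if_map_pmf_eq[OF fin finM]) (simp add: ni_law_commute ni_law_bind_simps comp_def)
  moreover have "ent ?W (\<lambda>w. (Xn w, F2 w)) = ent ?M (\<lambda>(s, f). (map fst s, f))"
    by (rule ent_eq_if_map_pmf_eq[OF fin finM]) (simp add: ni_law_commute ni_law_bind_simps comp_def)
  moreover have "real n * Delta2 P \<le> ent ?M (\<lambda>(s, f). (map (\<lambda>t. snd (snd t)) s, f))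
      - ent ?M (\<lambda>(s, f). (map fst s, f))"
    by (rule ent_diff_single_letter[where P = P and e = "enc_B c" and g = "\<lambda>t. fst (snd t)" and d = "Delta2 P"
        and \<zeta> = "\<lambda>t. snd (snd t)" and \<eta> = "fst" and n = n, OF finite fine Delta2_le])
  ultimately show ?thesis by simp
qed

text \<open>The second message depends on the other terminal's source only, so observing it cannot shrink
  the difference of the two entropies.\<close>

lemma ent_diff_mono_F2:
  fixes P :: "('x::finite \<times> 'y::finite \<times> 'z::finite) pmf" and c :: "('x, 'y) ni_scheme" and n :: nat
  assumes c: "finite_scheme c"
  defines "W \<equiv> ni_law P n c"
  shows "ent W (\<lambda>w. (Zn w, F1 w)) - ent W (\<lambda>w. (Yn w, F1 w)) \<le> ent W (\<lambda>w. (Zn w, F12 w)) - ent W (\<lambda>w. (Yn w, F12 w))"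
proof -
  have fin: "finite (set_pmf W)" unfolding W_def using c by (intro finite_set_ni_law) auto
  have law: "map_pmf (\<lambda>w. ((Xn w, Yn w, Zn w, F1 w), F2 w)) W
    = joint_pmf (map_pmf (\<lambda>w. (Xn w, Yn w, Zn w, F1 w)) W) (\<lambda>v. enc_B c (fst (snd v)))"
    unfolding W_def ni_law_F2 by (simp add: case_prod_beta')
  \<comment> \<open>Given \<open>Yn\<close>, the message \<open>F2\<close> is independent of the
    other source variables and of \<open>F1\<close>. Hence its entropy given \<open>(Yn, F1)\<close>
    equals that given \<open>(Xn, Yn, Zn, F1)\<close>, which by submodularity is at most that given
    \<open>(Zn, F1)\<close>.\<close>
  have "ent W (\<lambda>w. ((Xn w, Yn w, Zn w, F1 w), F2 w)) - ent W (\<lambda>w. (Xn w, Yn w, Zn w, F1 w))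
      = ent W (\<lambda>w. (Yn w, F2 w)) - ent W Yn"
    using ent_markov[where k = "enc_B c" and g = "\<lambda>v. fst (snd v)" and \<phi> = "\<lambda>v. v", OF fin law] by simp
  moreover have "ent W (\<lambda>w. ((Yn w, F1 w), F2 w)) - ent W (\<lambda>w. (Yn w, F1 w))
      = ent W (\<lambda>w. (Yn w, F2 w)) - ent W Yn"
    using ent_markov[where k = "enc_B c" and g = "\<lambda>v. fst (snd v)" and \<phi> = "\<lambda>v. (fst (snd v), snd (snd (snd v)))", OF fin law] by simp
  moreover have "ent W (\<lambda>w. (F2 w, (Xn w, Yn w), (Zn w, F1 w))) + ent W (\<lambda>w. (Zn w, F1 w))
      \<le> ent W (\<lambda>w. (F2 w, (Zn w, F1 w))) + ent W (\<lambda>w. ((Xn w, Yn w), (Zn w, F1 w)))"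
    by (rule ent_submodular[OF fin])
  moreover have "ent W (\<lambda>w. (F2 w, (Xn w, Yn w), (Zn w, F1 w))) = ent W (\<lambda>w. ((Xn w, Yn w, Zn w, F1 w), F2 w))"
    by (rule ent_cong[OF fin]) auto
  moreover have "ent W (\<lambda>w. ((Xn w, Yn w), (Zn w, F1 w))) = ent W (\<lambda>w. (Xn w, Yn w, Zn w, F1 w))"
    by (rule ent_cong[OF fin]) auto
  moreover have "ent W (\<lambda>w. (F2 w, (Zn w, F1 w))) = ent W (\<lambda>w. (Zn w, F12 w))"
    by (rule ent_cong[OF fin]) (auto simp: outcome_defs)
  moreover have "ent W (\<lambda>w. ((Yn w, F1 w), F2 w)) = ent W (\<lambda>w. (Yn w, F12 w))"
    by (rule ent_cong[OF fin]) (auto simp: outcome_defs)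
  ultimately show ?thesis by linarith
qed

lemma ent_diff_mono_F1:
  fixes P :: "('x::finite \<times> 'y::finite \<times> 'z::finite) pmf" and c :: "('x, 'y) ni_scheme" and n :: nat
  assumes c: "finite_scheme c"
  defines "W \<equiv> ni_law P n c"
  shows "ent W (\<lambda>w. (Zn w, F2 w)) - ent W (\<lambda>w. (Xn w, F2 w)) \<le> ent W (\<lambda>w. (Zn w, F12 w)) - ent W (\<lambda>w. (Xn w, F12 w))"
proof -
  have fin: "finite (set_pmf W)" unfolding W_def using c by (intro finite_set_ni_law) auto
  have law: "map_pmf (\<lambda>w. ((Xn w, Yn w, Zn w, F2 w), F1 w)) W
    = joint_pmf (map_pmf (\<lambda>w. (Xn w, Yn w, Zn w, F2 w)) W) (\<lambda>v. enc_A c (fst v))"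
    unfolding W_def ni_law_F1 by (simp add: case_prod_beta')
  have "ent W (\<lambda>w. ((Xn w, Yn w, Zn w, F2 w), F1 w)) - ent W (\<lambda>w. (Xn w, Yn w, Zn w, F2 w))
      = ent W (\<lambda>w. (Xn w, F1 w)) - ent W Xn"
    using ent_markov[where k = "enc_A c" and g = "fst" and \<phi> = "\<lambda>v. v", OF fin law] by simp
  moreover have "ent W (\<lambda>w. ((Xn w, F2 w), F1 w)) - ent W (\<lambda>w. (Xn w, F2 w))
      = ent W (\<lambda>w. (Xn w, F1 w)) - ent W Xn"
    using ent_markov[where k = "enc_A c" and g = "fst" and \<phi> = "\<lambda>v. (fst v, snd (snd (snd v)))", OF fin law] by simp
  moreover have "ent W (\<lambda>w. (F1 w, (Xn w, Yn w), (Zn w, F2 w))) + ent W (\<lambda>w. (Zn w, F2 w))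
      \<le> ent W (\<lambda>w. (F1 w, (Zn w, F2 w))) + ent W (\<lambda>w. ((Xn w, Yn w), (Zn w, F2 w)))"
    by (rule ent_submodular[OF fin])
  moreover have "ent W (\<lambda>w. (F1 w, (Xn w, Yn w), (Zn w, F2 w))) = ent W (\<lambda>w. ((Xn w, Yn w, Zn w, F2 w), F1 w))"
    by (rule ent_cong[OF fin]) auto
  moreover have "ent W (\<lambda>w. ((Xn w, Yn w), (Zn w, F2 w))) = ent W (\<lambda>w. (Xn w, Yn w, Zn w, F2 w))"
    by (rule ent_cong[OF fin]) auto
  moreover have "ent W (\<lambda>w. (F1 w, (Zn w, F2 w))) = ent W (\<lambda>w. (Zn w, F12 w))"
    by (rule ent_cong[OF fin]) (auto simp: outcome_defs)
  moreover have "ent W (\<lambda>w. ((Xn w, F2 w), F1 w)) = ent W (\<lambda>w. (Xn w, F12 w))"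
    by (rule ent_cong[OF fin]) (auto simp: outcome_defs)
  ultimately show ?thesis by linarith
qed

text \<open>Data processing: given one party's source and the messages, the two keys are
  independent, so that information predicts \<open>KA\<close> at least as well as \<open>KB\<close>
  does. The second bound has content too, because \<open>KA\<close> may use local randomness and
  need not be a function of \<open>(Xn, F12)\<close>.\<close>

lemma ent_KA_given_source:
  fixes P :: "('x::finite \<times> 'y::finite \<times> 'z::finite) pmf" and c :: "('x, 'y) ni_scheme" and n :: nat
  assumes c: "finite_scheme c"
  defines "W \<equiv> ni_law P n c"
  shows "ent W (\<lambda>w. (KA w, Yn w, F12 w)) - ent W (\<lambda>w. (Yn w, F12 w)) \<le> ent W (\<lambda>w. (KA w, KB w)) - ent W KB"
    and "ent W (\<lambda>w. (KA w, Xn w, F12 w)) - ent W (\<lambda>w. (Xn w, F12 w)) \<le> ent W (\<lambda>w. (KA w, KB w)) - ent W KB"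
proof -
  have fin: "finite (set_pmf W)" unfolding W_def using c by (intro finite_set_ni_law) auto
  have lawB: "map_pmf (\<lambda>w. ((Xn w, Yn w, F1 w, F2 w, KA w), KB w)) W
    = joint_pmf (map_pmf (\<lambda>w. (Xn w, Yn w, F1 w, F2 w, KA w)) W)
        (\<lambda>v. (\<lambda>(ys, f1, f2). key_B c ys f1 f2) ((\<lambda>(xs, ys, f1, f2, kA). (ys, f1, f2)) v))"
    unfolding W_def ni_law_KB by (simp add: case_prod_beta')
  have "ent W (\<lambda>w. ((KA w, Yn w, F1 w, F2 w), KB w)) - ent W (\<lambda>w. (KA w, Yn w, F1 w, F2 w))
      = ent W (\<lambda>w. ((Yn w, F1 w, F2 w), KB w)) - ent W (\<lambda>w. (Yn w, F1 w, F2 w))"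
    using ent_markov[where k = "\<lambda>(ys, f1, f2). key_B c ys f1 f2" and g = "\<lambda>(xs, ys, f1, f2, kA). (ys, f1, f2)" and \<phi> = "\<lambda>(xs, ys, f1, f2, kA). (kA, ys, f1, f2)", OF fin lawB] by auto
  moreover have "ent W (\<lambda>w. (KA w, (Yn w, F12 w), KB w)) + ent W KB
      \<le> ent W (\<lambda>w. (KA w, KB w)) + ent W (\<lambda>w. ((Yn w, F12 w), KB w))"
    by (rule ent_submodular[OF fin])
  moreover have "ent W (\<lambda>w. (KA w, (Yn w, F12 w), KB w)) = ent W (\<lambda>w. ((KA w, Yn w, F1 w, F2 w), KB w))"
    "ent W (\<lambda>w. ((Yn w, F12 w), KB w)) = ent W (\<lambda>w. ((Yn w, F1 w, F2 w), KB w))"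
    "ent W (\<lambda>w. (KA w, Yn w, F12 w)) = ent W (\<lambda>w. (KA w, Yn w, F1 w, F2 w))"
    "ent W (\<lambda>w. (Yn w, F12 w)) = ent W (\<lambda>w. (Yn w, F1 w, F2 w))"
    by (rule ent_cong[OF fin], force simp: outcome_defs)+
  ultimately show "ent W (\<lambda>w. (KA w, Yn w, F12 w)) - ent W (\<lambda>w. (Yn w, F12 w)) \<le> ent W (\<lambda>w. (KA w, KB w)) - ent W KB"
    by linarith
  have lawA: "map_pmf (\<lambda>w. ((Xn w, Yn w, F1 w, F2 w, KB w), KA w)) W
    = joint_pmf (map_pmf (\<lambda>w. (Xn w, Yn w, F1 w, F2 w, KB w)) W)
        (\<lambda>v. (\<lambda>(xs, f1, f2). key_A c xs f1 f2) ((\<lambda>(xs, ys, f1, f2, kB). (xs, f1, f2)) v))"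
    unfolding W_def ni_law_KA by (simp add: case_prod_beta')
  have "ent W (\<lambda>w. ((KB w, Xn w, F1 w, F2 w), KA w)) - ent W (\<lambda>w. (KB w, Xn w, F1 w, F2 w))
      = ent W (\<lambda>w. ((Xn w, F1 w, F2 w), KA w)) - ent W (\<lambda>w. (Xn w, F1 w, F2 w))"
    using ent_markov[where k = "\<lambda>(xs, f1, f2). key_A c xs f1 f2" and g = "\<lambda>(xs, ys, f1, f2, kB). (xs, f1, f2)" and \<phi> = "\<lambda>(xs, ys, f1, f2, kB). (kB, xs, f1, f2)", OF fin lawA] by auto
  moreover have "ent W (\<lambda>w. (KA w, (Xn w, F12 w), KB w)) + ent W KB
      \<le> ent W (\<lambda>w. (KA w, KB w)) + ent W (\<lambda>w. ((Xn w, F12 w), KB w))"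
    by (rule ent_submodular[OF fin])
  moreover have "ent W (\<lambda>w. (KA w, (Xn w, F12 w), KB w)) = ent W (\<lambda>w. ((KB w, Xn w, F1 w, F2 w), KA w))"
    "ent W (\<lambda>w. ((Xn w, F12 w), KB w)) = ent W (\<lambda>w. (KB w, Xn w, F1 w, F2 w))"
    "ent W (\<lambda>w. (KA w, Xn w, F12 w)) = ent W (\<lambda>w. ((Xn w, F1 w, F2 w), KA w))"
    "ent W (\<lambda>w. (Xn w, F12 w)) = ent W (\<lambda>w. (Xn w, F1 w, F2 w))"
    by (rule ent_cong[OF fin], force simp: outcome_defs)+
  ultimately show "ent W (\<lambda>w. (KA w, Xn w, F12 w)) - ent W (\<lambda>w. (Xn w, F12 w)) \<le> ent W (\<lambda>w. (KA w, KB w)) - ent W KB"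
    by linarith
qed

lemma ni_code_delta_nonneg: "ni_code P n R \<delta> c \<Longrightarrow> 0 \<le> \<delta>"
  unfolding ni_code_def using measure_pmf.prob_le_1[of "ni_law P n c" "{w. KA w = KB w}"] by linarith

section \<open>Lower bound on the equivocation\<close>

text \<open>By secrecy the key keeps almost all of its entropy given the messages, and by Fano's
  inequality little of it remains once a source is also known; the source must account for the
  difference. The terms of \<open>\<epsilon>\<close> are the leakage, the constant bit of Fano's
  inequality, and the error probability times the normalized logarithm of the key alphabet
  size.\<close>

lemma ni_code_source_ent_given_messages:
  fixes P :: "('x::finite \<times> 'y::finite \<times> 'z::finite) pmf" and c :: "('x, 'y) ni_scheme"
  assumes code: "ni_code P n R \<delta> c"
  defines "W \<equiv> ni_law P n c" and "\<epsilon> \<equiv> \<delta> + 1 / n + \<delta> * (R + \<delta>)"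
  shows "real n * (R - \<epsilon>) \<le> ent W (\<lambda>w. (Yn w, F12 w)) - ent W F12"
    and "real n * (R - \<epsilon>) \<le> ent W (\<lambda>w. (Xn w, F12 w)) - ent W F12"
proof -
  have c: "finite_scheme c" and n: "n \<ge> 1" and R: "ent W KA = n * R"
    and agree: "measure_pmf.prob W {w. KA w = KB w} \<ge> 1 - \<delta>"
    and card: "log 2 (card (alph_K c)) / n \<le> R + \<delta>"
    and leak: "mut_info W KA (\<lambda>w. (Zn w, F12 w)) / n \<le> \<delta>"
    using code unfolding ni_code_def W_def by auto
  have fin: "finite (set_pmf W)" unfolding W_def using c by (intro finite_set_ni_law) auto
  have finK: "finite (alph_K c)" "KA ` set_pmf W \<subseteq> alph_K c"
    using c unfolding W_def by (simp add: finite_scheme_def) (rule image_subsetI, rule KA_alph[OF _ c])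
  have "alph_K c \<noteq> {}" using finK(2) set_pmf_not_empty[of W] by auto
  then have "card (alph_K c) \<ge> 1" using finK(1) by (simp add: Suc_leI card_gt_0_iff)
  then have log0: "0 \<le> log 2 (card (alph_K c))" by simp
  have "measure_pmf.prob W {w. KA w \<noteq> KB w} = 1 - measure_pmf.prob W {w. KA w = KB w}"
    using measure_pmf.prob_compl[of "{w. KA w = KB w}" W] by (simp add: Compl_eq Compl_eq_Diff_UNIV[symmetric])
  then have err: "measure_pmf.prob W {w. KA w \<noteq> KB w} \<le> \<delta>" using agree by simp
  have "ent W (\<lambda>w. (KA w, KB w)) - ent W KB
      \<le> 1 + measure_pmf.prob W {w. KA w \<noteq> KB w} * log 2 (card (alph_K c))"
    by (rule fano_inequality[OF fin finK])
  also have "\<dots> \<le> 1 + \<delta> * log 2 (card (alph_K c))"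
    using err log0 by (intro add_left_mono mult_right_mono)
  also have "\<dots> \<le> 1 + \<delta> * (n * (R + \<delta>))"
    using card n ni_code_delta_nonneg[OF code]
    by (intro add_left_mono mult_left_mono) (simp_all add: pos_divide_le_eq mult.commute)
  finally have fano: "ent W (\<lambda>w. (KA w, KB w)) - ent W KB \<le> 1 + \<delta> * (n * (R + \<delta>))" .
  have "mut_info W KA (\<lambda>w. (Zn w, F12 w)) \<le> n * \<delta>"
    using leak n by (simp add: pos_divide_le_eq mult.commute)
  \<comment> \<open>Secrecy against \<open>(Zn, F12)\<close> implies secrecy against
    \<open>F12\<close> alone.\<close>
  moreover have "ent W (\<lambda>w. (KA w, Zn w, F12 w)) + ent W F12 \<le> ent W (\<lambda>w. (KA w, F12 w)) + ent W (\<lambda>w. (Zn w, F12 w))"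
    by (rule ent_submodular[OF fin])
  ultimately have key: "n * R - n * \<delta> \<le> ent W (\<lambda>w. (KA w, F12 w)) - ent W F12"
    using R by (simp add: mut_info_eq[OF fin])
  have eps: "real n * (R - \<epsilon>) = n * R - n * \<delta> - (1 + \<delta> * (n * (R + \<delta>)))"
    using n by (simp add: \<epsilon>_def field_simps)
  have "ent W (\<lambda>w. (KA w, F12 w)) \<le> ent W (\<lambda>w. (KA w, Yn w, F12 w))"
    "ent W (\<lambda>w. (KA w, F12 w)) \<le> ent W (\<lambda>w. (KA w, Xn w, F12 w))"
    by (rule ent_mono[OF fin], simp)+
  then show "real n * (R - \<epsilon>) \<le> ent W (\<lambda>w. (Yn w, F12 w)) - ent W F12"
    and "real n * (R - \<epsilon>) \<le> ent W (\<lambda>w. (Xn w, F12 w)) - ent W F12"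
    using ent_KA_given_source[OF c, of P n, folded W_def] key fano unfolding eps by linarith+
qed

text \<open>The single-letter bound, the passage from one message to both, and the source entropy
  bound add up, once through \<open>Yn\<close> for \<open>Delta1\<close> and once through
  \<open>Xn\<close> for \<open>Delta2\<close>.\<close>

theorem ni_code_equivocation:
  fixes P :: "('x::finite \<times> 'y::finite \<times> 'z::finite) pmf" and c :: "('x, 'y) ni_scheme"
  assumes code: "ni_code P n R \<delta> c"
  shows "max (Delta1 P) (Delta2 P) + R - (\<delta> + 1 / n + \<delta> * (R + \<delta>)) \<le> cond_ent (ni_law P n c) Zn F12 / n"
proof -
  let ?W = "ni_law P n c"
  have c: "finite_scheme c" and n: "n \<ge> 1" using code unfolding ni_code_def by auto
  have fin: "finite (set_pmf ?W)" using c by (intro finite_set_ni_law) auto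
  have "real n * (Delta1 P + R - (\<delta> + 1 / n + \<delta> * (R + \<delta>))) \<le> cond_ent ?W Zn F12"
    using ent_diff_ge_Delta1[OF c, of n P] ent_diff_mono_F2[OF c, of P n]
      ni_code_source_ent_given_messages(1)[OF code]
    unfolding cond_ent_eq[OF fin] by (simp add: algebra_simps)
  moreover have "real n * (Delta2 P + R - (\<delta> + 1 / n + \<delta> * (R + \<delta>))) \<le> cond_ent ?W Zn F12"
    using ent_diff_ge_Delta2[OF c, of n P] ent_diff_mono_F1[OF c, of P n]
      ni_code_source_ent_given_messages(2)[OF code]
    unfolding cond_ent_eq[OF fin] by (simp add: algebra_simps)
  ultimately show ?thesis
    using n by (simp add: pos_le_divide_eq mult.commute max_def)
qed

section \<open>A priori bounds\<close>

lemma card_lists_length_UNIV: "card {xs :: 'a::finite list. length xs = n} = CARD('a) ^ n"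
  using card_lists_length_eq[of "UNIV :: 'a set" n] by simp

lemma log_card_lists_length:
  "log 2 (card {xs :: 'a::finite list. length xs = n}) = n * log 2 CARD('a)"
  unfolding card_lists_length_UNIV by (simp add: log_nat_power)

lemma finite_lists_length_UNIV: "finite {xs :: 'a::finite list. length xs = n}"
  using finite_lists_length_eq[of "UNIV :: 'a set" n] by simp

lemma ent_cond_le_log_card:
  fixes B :: "'w \<Rightarrow> 'b::finite list"
  assumes fin: "finite (set_pmf W)" and len: "\<And>w. w \<in> set_pmf W \<Longrightarrow> length (B w) = n"
  shows "ent W (\<lambda>w. (B w, A w)) - ent W A \<le> n * log 2 CARD('b)"
proof -
  have "B ` set_pmf W \<subseteq> {xs. length xs = n}"
    by (rule image_subsetI) (simp add: len)
  then have "ent W B \<le> n * log 2 CARD('b)"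
    unfolding log_card_lists_length[symmetric]
    by (rule ent_le_log_card[OF fin finite_lists_length_UNIV])
  then show ?thesis using ent_subadditive[OF fin, of B A] by linarith
qed

text \<open>Boundedness will provide convergent subsequences of normalized equivocations, and the
  lower bound makes their limits nonnegative.\<close>

lemma cond_ent_Zn_bounds:
  fixes P :: "('x::finite \<times> 'y::finite \<times> 'z::finite) pmf"
  assumes c: "finite_scheme c" and n: "n \<ge> 1"
  shows "0 \<le> cond_ent (ni_law P n c) Zn F12 / n" "cond_ent (ni_law P n c) Zn F12 / n \<le> log 2 CARD('z)"
proof -
  let ?W = "ni_law P n c"
  have fin: "finite (set_pmf ?W)" using c by (intro finite_set_ni_law) auto
  have "ent ?W F12 \<le> ent ?W (\<lambda>w. (Zn w, F12 w))" by (rule ent_mono[OF fin]) simp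
  then show "0 \<le> cond_ent ?W Zn F12 / n" by (simp add: cond_ent_eq[OF fin])
  have "ent ?W (\<lambda>w. (Zn w, F12 w)) - ent ?W F12 \<le> n * log 2 CARD('z)"
    using length_ni_law by (intro ent_cond_le_log_card[OF fin]) blast
  then show "cond_ent ?W Zn F12 / n \<le> log 2 CARD('z)"
    using n by (simp add: cond_ent_eq[OF fin] pos_divide_le_eq mult.commute)
qed

text \<open>One code of tolerance one half is enough: about half of \<open>R\<close> survives the
  losses and must be covered by the entropy of \<open>Yn\<close> per letter.\<close>

lemma ni_achievable_bdd_above:
  fixes P :: "('x::finite \<times> 'y::finite \<times> 'z::finite) pmf"
  shows "bdd_above {R. ni_achievable P R}"
proof (rule bdd_aboveI, clarify)
  fix R assume "ni_achievable P R"
  then obtain n c where code: "ni_code P n R (1 / 2) c"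
    unfolding ni_achievable_def by (meson half_gt_zero zero_less_one)
  let ?W = "ni_law P n c"
  have c: "finite_scheme c" and n: "n \<ge> 1" using code unfolding ni_code_def by auto
  have fin: "finite (set_pmf ?W)" using c by (intro finite_set_ni_law) auto
  have "real n * (R - (1 / 2 + 1 / n + 1 / 2 * (R + 1 / 2))) \<le> ent ?W (\<lambda>w. (Yn w, F12 w)) - ent ?W F12"
    by (rule ni_code_source_ent_given_messages(1)[OF code])
  also have "\<dots> \<le> n * log 2 CARD('y)"
    using length_ni_law by (intro ent_cond_le_log_card[OF fin]) blast
  finally have "R - (1 / 2 + 1 / n + 1 / 2 * (R + 1 / 2)) \<le> log 2 CARD('y)"
    using n by simp
  moreover have "1 / real n \<le> 1" using n by simp
  ultimately show "R \<le> 2 * log 2 CARD('y) + 4" by (simp add: field_simps)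
qed

section \<open>Independent pairs of experiments\<close>

lemma pair_bind_pmf:
  "pair_pmf (A \<bind> f) (B \<bind> g) = pair_pmf A B \<bind> (\<lambda>(a, b). pair_pmf (f a) (g b))"
proof -
  have "pair_pmf (A \<bind> f) (B \<bind> g)
      = A \<bind> (\<lambda>a. f a \<bind> (\<lambda>x. B \<bind> (\<lambda>b. g b \<bind> (\<lambda>y. return_pmf (x, y)))))"
    by (simp add: pair_pmf_def bind_assoc_pmf)
  also have "\<dots> = A \<bind> (\<lambda>a. B \<bind> (\<lambda>b. f a \<bind> (\<lambda>x. g b \<bind> (\<lambda>y. return_pmf (x, y)))))"
    by (subst bind_commute_pmf) simp
  also have "\<dots> = pair_pmf A B \<bind> (\<lambda>(a, b). pair_pmf (f a) (g b))"
    by (simp add: pair_pmf_def bind_assoc_pmf bind_return_pmf)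
  finally show ?thesis .
qed

lemma pair_bind_pmf1: "pair_pmf (A \<bind> f) B = A \<bind> (\<lambda>a. pair_pmf (f a) B)"
  by (simp add: pair_pmf_def bind_assoc_pmf)

lemma pair_pmf_eq_joint_pmf: "pair_pmf p q = joint_pmf p (\<lambda>_. q)"
  by (simp add: pair_pmf_def joint_pmf_def map_pmf_def)

text \<open>A product law is a joint law whose kernel ignores its input, hence the trivial
  \<open>g\<close> into \<open>unit\<close>.\<close>

lemma ent_pair_pmf:
  assumes fin: "finite (set_pmf p)" "finite (set_pmf q)"
  shows "ent (pair_pmf p q) (\<lambda>(u, v). (A u, B v)) = ent p A + ent q B"
proof -
  let ?k = "\<lambda>_ :: unit. map_pmf B q"
  have "ent (pair_pmf p q) (\<lambda>(u, v). (A u, B v)) = ent (joint_pmf p (\<lambda>w. ?k ())) (\<lambda>(w, a). (A w, a))"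
  proof (rule ent_eq_if_map_pmf_eq)
    show "map_pmf (\<lambda>(u, v). (A u, B v)) (pair_pmf p q)
        = map_pmf (\<lambda>(w, a). (A w, a)) (joint_pmf p (\<lambda>w. ?k ()))"
      by (simp add: pair_pmf_eq_joint_pmf joint_pmf_def map_bind_pmf map_pmf_comp)
  qed (use fin in auto)
  also have "\<dots> = ent p A + (\<Sum>w\<in>set_pmf p. pmf p w * ent (map_pmf B q) (\<lambda>a. a))"
    by (rule ent_kernel[where g = "\<lambda>_. ()" and k = ?k and \<phi> = A]) (use fin in simp_all)
  also have "(\<Sum>w\<in>set_pmf p. pmf p w * ent (map_pmf B q) (\<lambda>a. a)) = (\<Sum>w\<in>set_pmf p. pmf p w) * ent q B"
    by (simp add: ent_map_pmf[OF fin(2)] sum_distrib_right)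
  also have "(\<Sum>w\<in>set_pmf p. pmf p w) = 1"
    using fin(1) by (intro sum_pmf_eq_1) auto
  finally show ?thesis by simp
qed

section \<open>Repeating a code\<close>

text \<open>Two independent runs on the halves of a block, where \<open>n\<close> is the blocklength
  of the inner code. Alphabets consist of natural numbers, so pairs of messages and of keys are
  packed by \<open>prod_encode\<close>.\<close>

definition double_scheme :: "nat \<Rightarrow> ('x, 'y) ni_scheme \<Rightarrow> ('x, 'y) ni_scheme" where
  "double_scheme n c = \<lparr>
     alph_F1 = prod_encode ` (alph_F1 c \<times> alph_F1 c),
     alph_F2 = prod_encode ` (alph_F2 c \<times> alph_F2 c),
     alph_K = prod_encode ` (alph_K c \<times> alph_K c),
     enc_A = (\<lambda>xs. map_pmf prod_encode (pair_pmf (enc_A c (take n xs)) (enc_A c (drop n xs)))),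
     enc_B = (\<lambda>ys. map_pmf prod_encode (pair_pmf (enc_B c (take n ys)) (enc_B c (drop n ys)))),
     key_A = (\<lambda>xs f1 f2. map_pmf prod_encode
       (pair_pmf (key_A c (take n xs) (fst (prod_decode f1)) (fst (prod_decode f2)))
          (key_A c (drop n xs) (snd (prod_decode f1)) (snd (prod_decode f2))))),
     key_B = (\<lambda>ys f1 f2. map_pmf prod_encode
       (pair_pmf (key_B c (take n ys) (fst (prod_decode f1)) (fst (prod_decode f2)))
          (key_B c (drop n ys) (snd (prod_decode f1)) (snd (prod_decode f2)))))\<rparr>"

definition join_outcomes ::
  "('x, 'y, 'z) outcome \<times> ('x, 'y, 'z) outcome \<Rightarrow> ('x, 'y, 'z) outcome" where
  "join_outcomes = (\<lambda>((xs, ys, zs, f1, f2, kA, kB), (xs', ys', zs', f1', f2', kA', kB')).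
     (xs @ xs', ys @ ys', zs @ zs', prod_encode (f1, f1'), prod_encode (f2, f2'),
      prod_encode (kA, kA'), prod_encode (kB, kB')))"

lemma join_outcomes_simps [simp]:
  "Zn (join_outcomes (u, v)) = Zn u @ Zn v"
  "F1 (join_outcomes (u, v)) = prod_encode (F1 u, F1 v)"
  "F2 (join_outcomes (u, v)) = prod_encode (F2 u, F2 v)"
  "KA (join_outcomes (u, v)) = prod_encode (KA u, KA v)"
  "KB (join_outcomes (u, v)) = prod_encode (KB u, KB v)"
  by (simp_all add: join_outcomes_def outcome_defs case_prod_beta)

lemma F12_eq: "F12 w = (F1 w, F2 w)"
  by (simp add: outcome_defs case_prod_beta)

lemma replicate_pmf_add: "replicate_pmf (m + n) P
    = map_pmf (\<lambda>(s, s'). s @ s') (pair_pmf (replicate_pmf m P) (replicate_pmf n P))"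
  by (simp add: replicate_pmf_distrib pair_pmf_def map_pmf_def bind_assoc_pmf bind_return_pmf)

text \<open>Separating the protocol from the source law lets transformations of schemes be analysed
  for one fixed source block at a time.\<close>

definition ni_run ::
  "('x, 'y) ni_scheme \<Rightarrow> ('x \<times> 'y \<times> 'z) list \<Rightarrow> ('x, 'y, 'z) outcome pmf" where
  "ni_run c s = enc_A c (map fst s) \<bind> (\<lambda>f1. enc_B c (map (fst \<circ> snd) s) \<bind> (\<lambda>f2.
     key_A c (map fst s) f1 f2 \<bind> (\<lambda>kA. key_B c (map (fst \<circ> snd) s) f1 f2 \<bind> (\<lambda>kB.
     return_pmf (map fst s, map (fst \<circ> snd) s, map (snd \<circ> snd) s, f1, f2, kA, kB)))))"

lemma ni_law_eq_ni_run: "ni_law P n c = replicate_pmf n P \<bind> ni_run c"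
  by (simp add: ni_law_def ni_run_def[abs_def] Let_def)

lemma ni_run_double_scheme:
  "length s = n \<Longrightarrow>
    ni_run (double_scheme n c) (s @ s') = map_pmf join_outcomes (pair_pmf (ni_run c s) (ni_run c s'))"
  by (simp add: ni_run_def double_scheme_def bind_map_pmf map_bind_pmf pair_bind_pmf case_prod_beta'
    join_outcomes_def)

lemma ni_law_double_scheme:
  "ni_law P (n + n) (double_scheme n c) = map_pmf join_outcomes (pair_pmf (ni_law P n c) (ni_law P n c))"
  unfolding ni_law_eq_ni_run replicate_pmf_add pair_bind_pmf map_bind_pmf bind_map_pmf
  by (rule bind_pmf_cong[OF refl]) (auto simp: ni_run_double_scheme dest: length_replicate_pmf)

lemma prob_neq: "measure_pmf.prob W {w. f w \<noteq> g w} = 1 - measure_pmf.prob W {w. f w = g w}"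
  using measure_pmf.prob_compl[of "{w. f w = g w}" W] by (simp add: Compl_eq Compl_eq_Diff_UNIV[symmetric])

lemma finite_double_scheme:
  assumes c: "finite_scheme c"
  shows "finite_scheme (double_scheme n c)"
proof -
  have A: "set_pmf (enc_A c xs) \<subseteq> alph_F1 c" "set_pmf (enc_B c ys) \<subseteq> alph_F2 c"
    "set_pmf (key_A c xs f1 f2) \<subseteq> alph_K c" "set_pmf (key_B c ys f1 f2) \<subseteq> alph_K c" for xs ys f1 f2
    using c unfolding finite_scheme_def by blast+
  show ?thesis
    using c unfolding finite_scheme_def double_scheme_def
    by (simp, intro conjI allI image_mono Sigma_mono A)
qed

text \<open>Entropies of independent pairs add, so rate, leakage and logarithm of the alphabet size
  stay the same per letter. The tolerance doubles because of the union bound on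
  disagreement.\<close>

lemma ni_code_double:
  fixes P :: "('x::finite \<times> 'y::finite \<times> 'z::finite) pmf"
  assumes code: "ni_code P n R \<delta> c"
  shows "ni_code P (n + n) R (2 * \<delta>) (double_scheme n c)"
proof -
  let ?W = "ni_law P n c" and ?c = "double_scheme n c"
  let ?W2 = "ni_law P (n + n) ?c" and ?p = "pair_pmf (ni_law P n c) (ni_law P n c)"
  have c: "finite_scheme c" and n: "n \<ge> 1" and R: "R = ent ?W KA / n"
    and agree: "measure_pmf.prob ?W {w. KA w = KB w} \<ge> 1 - \<delta>"
    and card: "R \<ge> log 2 (card (alph_K c)) / n - \<delta>"
    and leak: "mut_info ?W KA (\<lambda>w. (Zn w, F12 w)) / n \<le> \<delta>"
    using code unfolding ni_code_def by auto
  have fin: "finite (set_pmf ?W)" using c by (intro finite_set_ni_law) auto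
  then have finp: "finite (set_pmf ?p)" by simp
  have c2: "finite_scheme ?c" by (rule finite_double_scheme[OF c])
  have fin2: "finite (set_pmf ?W2)" using c2 by (intro finite_set_ni_law) auto
  \<comment> \<open>A concatenation determines its two parts only because the length of the first is
    fixed.\<close>
  have len: "length (Zn (fst v)) = length (Zn (fst w))" if "v \<in> set_pmf ?p" "w \<in> set_pmf ?p" for v w
    using that length_ni_law[of "fst v" P n c] length_ni_law[of "fst w" P n c] by auto
  have W2: "ent ?W2 A = ent ?p (\<lambda>w. A (join_outcomes w))" for A :: "_ \<Rightarrow> 'k::countable"
    unfolding ni_law_double_scheme by (rule ent_map_pmf[OF finp])
  have K: "ent ?W2 KA = 2 * ent ?W KA"
  proof -
    have "ent ?W2 KA = ent ?p (\<lambda>(u, v). (KA u, KA v))"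
      unfolding W2 by (rule ent_cong[OF finp]) auto
    then show ?thesis by (simp add: ent_pair_pmf[OF fin fin])
  qed
  have ZF: "ent ?W2 (\<lambda>w. (Zn w, F12 w)) = 2 * ent ?W (\<lambda>w. (Zn w, F12 w))"
  proof -
    have "ent ?W2 (\<lambda>w. (Zn w, F12 w)) = ent ?p (\<lambda>(u, v). ((Zn u, F12 u), (Zn v, F12 v)))"
      unfolding W2
    proof (rule ent_cong[OF finp])
      fix v w assume "v \<in> set_pmf ?p" "w \<in> set_pmf ?p"
      from len[OF this] have "length (Zn (fst v)) = length (Zn (fst w))" .
      then show "((\<lambda>(u, v). ((Zn u, F12 u), (Zn v, F12 v))) v = (\<lambda>(u, v). ((Zn u, F12 u), (Zn v, F12 v))) w)
          \<longleftrightarrow> (Zn (join_outcomes v), F12 (join_outcomes v)) = (Zn (join_outcomes w), F12 (join_outcomes w))"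
        by (cases v, cases w) (auto simp: F12_eq)
    qed
    then show ?thesis by (simp add: ent_pair_pmf[OF fin fin])
  qed
  have KZF: "ent ?W2 (\<lambda>w. (KA w, Zn w, F12 w)) = 2 * ent ?W (\<lambda>w. (KA w, Zn w, F12 w))"
  proof -
    have "ent ?W2 (\<lambda>w. (KA w, Zn w, F12 w)) = ent ?p (\<lambda>(u, v). ((KA u, Zn u, F12 u), (KA v, Zn v, F12 v)))"
      unfolding W2
    proof (rule ent_cong[OF finp])
      fix v w assume "v \<in> set_pmf ?p" "w \<in> set_pmf ?p"
      from len[OF this] have "length (Zn (fst v)) = length (Zn (fst w))" .
      then show "((\<lambda>(u, v). ((KA u, Zn u, F12 u), (KA v, Zn v, F12 v))) v = (\<lambda>(u, v). ((KA u, Zn u, F12 u), (KA v, Zn v, F12 v))) w)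
          \<longleftrightarrow> (KA (join_outcomes v), Zn (join_outcomes v), F12 (join_outcomes v))
            = (KA (join_outcomes w), Zn (join_outcomes w), F12 (join_outcomes w))"
        by (cases v, cases w) (auto simp: F12_eq)
    qed
    then show ?thesis by (simp add: ent_pair_pmf[OF fin fin])
  qed
  have "mut_info ?W2 KA (\<lambda>w. (Zn w, F12 w)) = 2 * mut_info ?W KA (\<lambda>w. (Zn w, F12 w))"
    unfolding mut_info_eq[OF fin2] mut_info_eq[OF fin] K ZF KZF by simp
  then have leak2: "mut_info ?W2 KA (\<lambda>w. (Zn w, F12 w)) / real (n + n) \<le> 2 * \<delta>"
    using leak ni_code_delta_nonneg[OF code] by simp
  have "measure_pmf.prob ?W2 {w. KA w \<noteq> KB w}
      \<le> measure_pmf.prob ?p (fst -` {w. KA w \<noteq> KB w} \<union> snd -` {w. KA w \<noteq> KB w})"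
    unfolding ni_law_double_scheme measure_map_pmf
    by (rule measure_pmf.finite_measure_mono) auto
  also have "\<dots> \<le> measure_pmf.prob ?p (fst -` {w. KA w \<noteq> KB w}) + measure_pmf.prob ?p (snd -` {w. KA w \<noteq> KB w})"
    by (rule measure_Un_le) auto
  also have "\<dots> = 2 * measure_pmf.prob ?W {w. KA w \<noteq> KB w}"
    unfolding measure_map_pmf[symmetric] map_fst_pair_pmf map_snd_pair_pmf by simp
  finally have agree2: "measure_pmf.prob ?W2 {w. KA w = KB w} \<ge> 1 - 2 * \<delta>"
    using agree unfolding prob_neq by simp
  have "card (alph_K ?c) = card (alph_K c) ^ 2"
    unfolding double_scheme_def
    by (simp add: card_image inj_prod_encode card_cartesian_product power2_eq_square)
  \<comment> \<open>For cardinality zero the equation rests on the default value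
    \<open>ln 0 = 0\<close>.\<close>
  then have "log 2 (card (alph_K ?c)) / real (n + n) = log 2 (card (alph_K c)) / n"
    by (cases "card (alph_K c) = 0") (simp_all add: log_def ln_realpow)
  then have card2: "R \<ge> log 2 (card (alph_K ?c)) / real (n + n) - 2 * \<delta>"
    using card ni_code_delta_nonneg[OF code] by linarith
  have "R = ent ?W2 KA / real (n + n)" unfolding K using R by simp
  then show ?thesis
    unfolding ni_code_def using n c2 agree2 card2 leak2 by simp
qed

text \<open>\<open>N\<close> doublings raise the blocklength to at least
  \<open>2 ^ N \<ge> N\<close> and multiply the tolerance by \<open>2 ^ N\<close>. Starting from
  tolerance \<open>\<delta> / 2 ^ N\<close> compensates, and the rate is unchanged.\<close>

lemma ni_code_long:
  fixes P :: "('x::finite \<times> 'y::finite \<times> 'z::finite) pmf"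
  assumes R: "ni_achievable P R" and \<delta>: "\<delta> > 0"
  shows "\<exists>n c. N \<le> n \<and> ni_code P n R \<delta> c"
proof -
  have *: "\<exists>c'. ni_code P (2 ^ j * n) R (2 ^ j * \<epsilon>) c'" if "ni_code P n R \<epsilon> c" for j n \<epsilon> c
  proof (induction j)
    case 0
    show ?case using that by (intro exI[of _ c]) simp
  next
    case (Suc j)
    then obtain c' where "ni_code P (2 ^ j * n) R (2 ^ j * \<epsilon>) c'" by blast
    note ni_code_double[OF this]
    moreover have "2 ^ j * n + 2 ^ j * n = 2 ^ Suc j * n" "2 * (2 ^ j * \<epsilon>) = 2 ^ Suc j * \<epsilon>"
      by simp_all
    ultimately have "ni_code P (2 ^ Suc j * n) R (2 ^ Suc j * \<epsilon>) (double_scheme (2 ^ j * n) c')"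
      by (simp only:)
    then show ?case ..
  qed
  have "0 < \<delta> / 2 ^ N" using \<delta> by simp
  then obtain n c where code: "ni_code P n R (\<delta> / 2 ^ N) c"
    using R unfolding ni_achievable_def by blast
  have "2 ^ N * (\<delta> / 2 ^ N) = \<delta>" by simp
  then obtain c' where c': "ni_code P (2 ^ N * n) R \<delta> c'" using *[OF code, of N] by metis
  have "n \<ge> 1" using code unfolding ni_code_def by simp
  then have "2 ^ N \<le> 2 ^ N * n" by simp
  moreover have "N \<le> 2 ^ N" by (simp add: less_imp_le)
  ultimately have "N \<le> 2 ^ N * n" by (rule order.trans[rotated])
  then show ?thesis using c' by blast
qed

section \<open>Lowering the rate of a code\<close>

text \<open>The delicate point is the left end, where \<open>t * log 2 t\<close> tends to 0, the
  value of the product there.\<close>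

lemma continuous_on_entropy_function: "continuous_on {0..1} (\<lambda>t::real. t * log 2 t)"
proof (rule continuous_on_IccI)
  show "((\<lambda>t::real. t * log 2 t) \<longlongrightarrow> 0 * log 2 0) (at_right 0)"
    by real_asymp
  show "((\<lambda>t::real. t * log 2 t) \<longlongrightarrow> 1 * log 2 1) (at_left 1)"
    by real_asymp
qed (auto intro!: tendsto_intros)

text \<open>A fixed index set is needed to vary the bias of a coin, because the support of the law
  can shrink at bias 0 and 1.\<close>

lemma ent_eq_sum_superset:
  assumes fin: "finite (set_pmf p)" and S: "finite S" "A ` set_pmf p \<subseteq> S"
  shows "ent p A = - (\<Sum>a\<in>S. pmf (map_pmf A p) a * log 2 (pmf (map_pmf A p) a))"
  unfolding ent_eq_sum[OF fin]
  by (intro arg_cong[of _ _ uminus] sum.mono_neutral_left S ballI) (simp add: pmf_eq_0_set_pmf)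

lemma pmf_map_coin:
  assumes q: "0 \<le> q" "q \<le> 1"
  shows "pmf (map_pmf (\<lambda>(b, w). h b w) (pair_pmf (bernoulli_pmf q) W)) a
    = q * pmf (map_pmf (h True) W) a + (1 - q) * pmf (map_pmf (h False) W) a"
proof -
  have "map_pmf (\<lambda>(b, w). h b w) (pair_pmf (bernoulli_pmf q) W) = bernoulli_pmf q \<bind> (\<lambda>b. map_pmf (h b) W)"
    by (simp add: pair_pmf_def map_bind_pmf map_pmf_def bind_assoc_pmf bind_return_pmf)
  then show ?thesis using q by (simp add: pmf_bind)
qed

lemma continuous_on_ent_coin:
  assumes fin: "finite (set_pmf W)"
  shows "continuous_on {0..1} (\<lambda>q. ent (pair_pmf (bernoulli_pmf q) W) (\<lambda>(b, w). h b w))"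
proof -
  let ?S = "h True ` set_pmf W \<union> h False ` set_pmf W"
  let ?m = "\<lambda>a q. q * pmf (map_pmf (h True) W) a + (1 - q) * pmf (map_pmf (h False) W) a"
  have "continuous_on {0..1} (\<lambda>q. - (\<Sum>a\<in>?S. ?m a q * log 2 (?m a q)))"
  proof (intro continuous_on_minus continuous_on_sum)
    fix a
    have "?m a q \<in> {0..1}" if "q \<in> {0..1}" for q
    proof -
      have "?m a q \<le> q * 1 + (1 - q) * 1"
        using that by (intro add_mono mult_left_mono) (auto simp: pmf_le_1)
      then show ?thesis using that by simp
    qed
    then show "continuous_on {0..1} (\<lambda>q. ?m a q * log 2 (?m a q))"
      by (intro continuous_on_compose2[OF continuous_on_entropy_function]) (auto intro!: continuous_intros)
  qed
  moreover have "ent (pair_pmf (bernoulli_pmf q) W) (\<lambda>(b, w). h b w) = - (\<Sum>a\<in>?S. ?m a q * log 2 (?m a q))"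
    if "q \<in> {0..1}" for q
  proof -
    have sub: "(\<lambda>(b, w). h b w) ` set_pmf (pair_pmf (bernoulli_pmf q) W) \<subseteq> ?S"
    proof clarify
      fix b w assume "(b, w) \<in> set_pmf (pair_pmf (bernoulli_pmf q) W)" "h b w \<notin> h False ` set_pmf W"
      then show "h b w \<in> h True ` set_pmf W" by (cases b) auto
    qed
    show ?thesis
      using that by (subst ent_eq_sum_superset[OF _ _ sub]) (use fin in \<open>simp_all add: pmf_map_coin\<close>)
  qed
  ultimately show ?thesis by (subst continuous_on_cong[OF refl])
qed

text \<open>Chain rule with the coin first: once it is revealed, the conditional entropy is the
  average over its two branches.\<close>

lemma ent_coin:
  assumes fin: "finite (set_pmf W)" and q: "0 \<le> q" "q \<le> 1"
  shows "ent (pair_pmf (bernoulli_pmf q) W) (\<lambda>(b, w). (b, h b w))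
    = ent (bernoulli_pmf q) (\<lambda>b. b) + q * ent W (h True) + (1 - q) * ent W (h False)"
proof -
  let ?B = "bernoulli_pmf q" and ?k = "\<lambda>b. map_pmf (h b) W"
  have "ent (pair_pmf ?B W) (\<lambda>(b, w). (b, h b w)) = ent (joint_pmf ?B ?k) (\<lambda>(b, a). (b, a))"
  proof (rule ent_eq_if_map_pmf_eq)
    show "map_pmf (\<lambda>(b, w). (b, h b w)) (pair_pmf ?B W) = map_pmf (\<lambda>(b, a). (b, a)) (joint_pmf ?B ?k)"
      by (simp add: pair_pmf_eq_joint_pmf joint_pmf_def map_bind_pmf map_pmf_comp)
  qed (use fin in auto)
  also have "\<dots> = ent ?B (\<lambda>b. b) + (\<Sum>b\<in>set_pmf ?B. pmf ?B b * ent (?k b) (\<lambda>a. a))"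
    by (rule ent_kernel[where g = "\<lambda>b. b" and k = ?k and \<phi> = "\<lambda>b. b"]) (use fin in simp_all)
  also have "(\<Sum>b\<in>set_pmf ?B. pmf ?B b * ent (?k b) (\<lambda>a. a)) = (\<Sum>b\<in>UNIV. pmf ?B b * ent W (h b))"
    by (rule sum.mono_neutral_cong_left) (auto simp: ent_map_pmf[OF fin] pmf_eq_0_set_pmf)
  finally show ?thesis using q by (simp add: UNIV_bool)
qed

text \<open>A public coin decides whether the key is kept, after compression by \<open>g\<close>, or erased: the
  entropy of the key then varies continuously with the bias of the coin.\<close>

definition erase_scheme ::
  "real \<Rightarrow> nat \<Rightarrow> (nat \<Rightarrow> nat) \<Rightarrow> ('x, 'y) ni_scheme \<Rightarrow> ('x, 'y) ni_scheme" where
  "erase_scheme q m g c = \<lparr>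
     alph_F1 = prod_encode ` (alph_F1 c \<times> {0, 1}),
     alph_F2 = alph_F2 c,
     alph_K = {..<m},
     enc_A = (\<lambda>xs. map_pmf (\<lambda>(f, b). prod_encode (f, of_bool b)) (pair_pmf (enc_A c xs) (bernoulli_pmf q))),
     enc_B = enc_B c,
     key_A = (\<lambda>xs f1 f2. map_pmf (\<lambda>k. if snd (prod_decode f1) = 1 then g k else 0)
       (key_A c xs (fst (prod_decode f1)) f2)),
     key_B = (\<lambda>ys f1 f2. map_pmf (\<lambda>k. if snd (prod_decode f1) = 1 then g k else 0)
       (key_B c ys (fst (prod_decode f1)) f2))\<rparr>"

definition erase_outcome ::
  "(nat \<Rightarrow> nat) \<Rightarrow> ('x, 'y, 'z) outcome \<times> bool \<Rightarrow> ('x, 'y, 'z) outcome" where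
  "erase_outcome g = (\<lambda>((xs, ys, zs, f1, f2, kA, kB), b).
     (xs, ys, zs, prod_encode (f1, of_bool b), f2, if b then g kA else 0, if b then g kB else 0))"

lemma ni_run_erase_scheme:
  "ni_run (erase_scheme q m g c) s = map_pmf (erase_outcome g) (pair_pmf (ni_run c s) (bernoulli_pmf q))"
proof -
  let ?B = "bernoulli_pmf q"
  \<comment> \<open>Moves the coin from the end of the run to the draw of the first message, where
    the scheme tosses it.\<close>
  have B: "pair_pmf (A \<bind> f) ?B = pair_pmf A ?B \<bind> (\<lambda>(a, b). map_pmf (\<lambda>x. (x, b)) (f a))" for A f
    using pair_bind_pmf[of A f ?B return_pmf] by (simp add: bind_return_pmf' pair_return_pmf2)
  have [simp]: "(of_bool b = Suc 0) = b" for b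
    by (cases b) simp_all
  show ?thesis
    unfolding ni_run_def B
    by (simp add: erase_scheme_def bind_map_pmf map_bind_pmf case_prod_beta' erase_outcome_def
      cong: if_cong)
qed

lemma ni_law_erase_scheme:
  "ni_law P n (erase_scheme q m g c) = map_pmf (\<lambda>(b, w). erase_outcome g (w, b)) (pair_pmf (bernoulli_pmf q) (ni_law P n c))"
proof -
  have "ni_law P n (erase_scheme q m g c) = map_pmf (erase_outcome g) (pair_pmf (ni_law P n c) (bernoulli_pmf q))"
    unfolding ni_law_eq_ni_run pair_bind_pmf1 map_bind_pmf
    by (rule bind_pmf_cong[OF refl]) (rule ni_run_erase_scheme)
  then show ?thesis
    by (subst (asm) pair_commute_pmf) (simp add: map_pmf_comp case_prod_beta')
qed

lemma finite_erase_scheme: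
  assumes c: "finite_scheme c" and m: "0 < m" and g: "\<And>k. g k < m"
  shows "finite_scheme (erase_scheme q m g c)"
proof -
  have A: "set_pmf (enc_A c xs) \<subseteq> alph_F1 c" "set_pmf (enc_B c ys) \<subseteq> alph_F2 c" for xs ys
    using c unfolding finite_scheme_def by blast+
  show ?thesis
    using c m g unfolding finite_scheme_def erase_scheme_def
    by (auto intro!: imageI dest: subsetD[OF A(1)])
qed

text \<open>The key entropy is 0 when the key is always erased and that of the compressed key when
  it is never erased, so by the intermediate value theorem some bias gives exactly
  \<open>n * R'\<close>. Leakage increases by at most the entropy of the coin, hence the extra
  \<open>1 / n\<close>; the condition on \<open>log 2 m\<close> is the uniformity requirement for
  the new alphabet.\<close>

lemma ni_code_erase:
  fixes P :: "('x::finite \<times> 'y::finite \<times> 'z::finite) pmf" and m :: nat and g :: "nat \<Rightarrow> nat"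
  assumes code: "ni_code P n R \<delta> c" and m: "0 < m" and g: "\<And>k. g k < m"
    and R': "0 \<le> R'" "n * R' \<le> ent (ni_law P n c) (\<lambda>w. g (KA w))" "log 2 m \<le> n * (R' + \<delta>')"
    and \<delta>': "\<delta> + 1 / n \<le> \<delta>'"
  shows "\<exists>c'. ni_code P n R' \<delta>' c'"
proof -
  let ?W = "ni_law P n c"
  let ?K = "\<lambda>w. g (KA w)" and ?F = "\<lambda>w. (Zn w, F12 w)"
  have c: "finite_scheme c" and n: "n \<ge> 1"
    and agree: "measure_pmf.prob ?W {w. KA w = KB w} \<ge> 1 - \<delta>"
    and leak: "mut_info ?W KA ?F / n \<le> \<delta>"
    using code unfolding ni_code_def by auto
  have fin: "finite (set_pmf ?W)" using c by (intro finite_set_ni_law) auto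
  define E where "E q = ent (pair_pmf (bernoulli_pmf q) ?W) (\<lambda>(b, w). if b then ?K w else 0)" for q
  have "continuous_on {0..1} E"
    unfolding E_def by (rule continuous_on_ent_coin[OF fin])
  moreover have "E 0 = ent ?W (\<lambda>_. 0::nat)"
    unfolding E_def
  proof (rule ent_eq_if_map_pmf_eq[where A = "\<lambda>(b, w). if b then ?K w else 0" and B = "\<lambda>_. 0"])
    show "map_pmf (\<lambda>(b, w). if b then ?K w else 0) (pair_pmf (bernoulli_pmf 0) ?W) = map_pmf (\<lambda>_. 0::nat) ?W"
    proof (rule pmf_eqI)
      fix a
      show "pmf (map_pmf (\<lambda>(b, w). if b then ?K w else 0) (pair_pmf (bernoulli_pmf 0) ?W)) a
          = pmf (map_pmf (\<lambda>_. 0::nat) ?W) a"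
        using pmf_map_coin[of 0 "\<lambda>b w. if b then ?K w else 0" ?W a] by simp
    qed
  qed (use fin in auto)
  moreover have "E 1 = ent ?W ?K"
    unfolding E_def
  proof (rule ent_eq_if_map_pmf_eq[where A = "\<lambda>(b, w). if b then ?K w else 0" and B = ?K])
    show "map_pmf (\<lambda>(b, w). if b then ?K w else 0) (pair_pmf (bernoulli_pmf 1) ?W) = map_pmf ?K ?W"
    proof (rule pmf_eqI)
      fix a
      show "pmf (map_pmf (\<lambda>(b, w). if b then ?K w else 0) (pair_pmf (bernoulli_pmf 1) ?W)) a = pmf (map_pmf ?K ?W) a"
        using pmf_map_coin[of 1 "\<lambda>b w. if b then ?K w else 0" ?W a] by simp
    qed
  qed (use fin in auto)
  ultimately obtain q where q: "0 \<le> q" "q \<le> 1" and Eq: "E q = n * R'"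
    using IVT'[of E 0 "n * R'" 1] R' ent_const[OF fin, of "0::nat"] by auto
  let ?c = "erase_scheme q m g c"
  let ?p = "pair_pmf (bernoulli_pmf q) ?W" and ?V = "ni_law P n ?c"
  have finp: "finite (set_pmf ?p)" using fin by simp
  have c': "finite_scheme ?c" by (rule finite_erase_scheme[OF c m g])
  have finV: "finite (set_pmf ?V)" using c' by (intro finite_set_ni_law) auto
  have V: "ent ?V A = ent ?p (\<lambda>(b, w). A (erase_outcome g (w, b)))" for A :: "_ \<Rightarrow> 'k::countable"
    unfolding ni_law_erase_scheme ent_map_pmf[OF finp] by (rule arg_cong[of _ _ "ent ?p"]) auto
  have K: "ent ?V KA = n * R'"
    unfolding V Eq[symmetric] E_def
    by (rule ent_cong[OF finp]) (auto simp: erase_outcome_def KA_def split: prod.splits)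
  let ?h = "ent (bernoulli_pmf q) (\<lambda>b. b)"
  \<comment> \<open>The coin is part of \<open>F12\<close>, so its entropy \<open>?h\<close> occurs
    exactly in the entropy of \<open>?F\<close> and in the joint one, and these cancel. For the key
    alone, revealing the coin gives an upper bound with one more \<open>?h\<close>, which is all
    that is lost.\<close>
  have "ent ?V KA \<le> ent ?p (\<lambda>(b, w). (b, if b then ?K w else 0))"
    unfolding V by (rule ent_mono[OF finp]) (auto simp: erase_outcome_def KA_def split: prod.splits)
  also have "\<dots> = ?h + q * ent ?W ?K"
    using ent_coin[OF fin q, of "\<lambda>b w. if b then ?K w else 0"] ent_const[OF fin, of "0::nat"] by simp
  finally have 1: "ent ?V KA \<le> ?h + q * ent ?W ?K" .
  have "ent ?V ?F = ent ?p (\<lambda>(b, w). (b, ?F w))"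
    unfolding V by (rule ent_cong[OF finp]) (auto simp: erase_outcome_def outcome_defs split: prod.splits)
  also have "\<dots> = ?h + ent ?W ?F"
    using ent_coin[OF fin q, of "\<lambda>b. ?F"] by (simp add: algebra_simps)
  finally have 2: "ent ?V ?F = ?h + ent ?W ?F" .
  have "ent ?V (\<lambda>w. (KA w, ?F w)) = ent ?p (\<lambda>(b, w). (b, if b then ?K w else 0, ?F w))"
    unfolding V by (rule ent_cong[OF finp]) (auto simp: erase_outcome_def outcome_defs split: prod.splits)
  also have "\<dots> = ?h + q * ent ?W (\<lambda>w. (?K w, ?F w)) + (1 - q) * ent ?W (\<lambda>w. (0::nat, ?F w))"
    using ent_coin[OF fin q, of "\<lambda>b w. (if b then ?K w else 0, ?F w)"] by simp
  also have "ent ?W (\<lambda>w. (0::nat, ?F w)) = ent ?W ?F"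
    by (rule ent_cong[OF fin]) simp
  finally have 3: "ent ?V (\<lambda>w. (KA w, ?F w)) = ?h + q * ent ?W (\<lambda>w. (?K w, ?F w)) + (1 - q) * ent ?W ?F" .
  have h: "?h \<le> 1"
    using ent_le_log_card[OF _ _ subset_UNIV, of "bernoulli_pmf q" "\<lambda>b. b"] by simp
  have "mut_info ?V KA ?F \<le> ?h + q * (ent ?W ?K + ent ?W ?F - ent ?W (\<lambda>w. (?K w, ?F w)))"
    unfolding mut_info_eq[OF finV] 2 3 using 1 by (simp add: algebra_simps)
  also have "\<dots> \<le> 1 + 1 * (ent ?W ?K + ent ?W ?F - ent ?W (\<lambda>w. (?K w, ?F w)))"
    using h q ent_subadditive[OF fin, of ?K ?F] by (intro add_mono mult_right_mono) auto
  \<comment> \<open>Data processing: the compressed key shares no more information with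
    \<open>?F\<close> than \<open>KA\<close> does.\<close>
  also have "\<dots> \<le> 1 + mut_info ?W KA ?F"
  proof -
    have "ent ?W (\<lambda>w. (KA w, ?F w, ?K w)) + ent ?W ?K \<le> ent ?W (\<lambda>w. (KA w, ?K w)) + ent ?W (\<lambda>w. (?F w, ?K w))"
      by (rule ent_submodular[OF fin])
    moreover have "ent ?W (\<lambda>w. (KA w, ?F w, ?K w)) = ent ?W (\<lambda>w. (KA w, ?F w))"
      by (rule ent_cong[OF fin]) auto
    moreover have "ent ?W (\<lambda>w. (KA w, ?K w)) = ent ?W KA"
      by (rule ent_cong[OF fin]) auto
    moreover have "ent ?W (\<lambda>w. (?F w, ?K w)) = ent ?W (\<lambda>w. (?K w, ?F w))"
      by (rule ent_cong[OF fin]) auto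
    ultimately show ?thesis unfolding mut_info_eq[OF fin] by simp
  qed
  finally have "mut_info ?V KA ?F / n \<le> (1 + mut_info ?W KA ?F) / n"
    by (simp add: divide_right_mono)
  then have leak': "mut_info ?V KA ?F / n \<le> \<delta>'"
    using leak \<delta>' by (simp add: add_divide_distrib)
  have "measure_pmf.prob ?V {w. KA w \<noteq> KB w} \<le> measure_pmf.prob ?p (snd -` {w. KA w \<noteq> KB w})"
    unfolding ni_law_erase_scheme measure_map_pmf
    by (rule measure_pmf.finite_measure_mono) (auto simp: erase_outcome_def KA_def KB_def)
  also have "\<dots> = measure_pmf.prob ?W {w. KA w \<noteq> KB w}"
    unfolding measure_map_pmf[symmetric] map_snd_pair_pmf ..
  also have "\<dots> \<le> \<delta>'"
  proof -
    have "0 \<le> 1 / real n" by simp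
    then show ?thesis using agree \<delta>' unfolding prob_neq by linarith
  qed
  finally have agree': "measure_pmf.prob ?V {w. KA w = KB w} \<ge> 1 - \<delta>'"
    unfolding prob_neq by simp
  have "card (alph_K ?c) = m" by (simp add: erase_scheme_def)
  then have "R' \<ge> log 2 (card (alph_K ?c)) / n - \<delta>'"
    using R'(3) n by (simp add: pos_divide_le_eq diff_le_eq mult.commute)
  then have "ni_code P n R' \<delta>' ?c"
    unfolding ni_code_def using n c' K agree' leak' by simp
  then show ?thesis ..
qed

text \<open>The keys are numbered and reduced modulo \<open>m\<close>. Residue and quotient
  determine the key, and the quotient takes at most twice \<open>card (alph_K c) / m\<close> values.
  As the entropy of \<open>KA\<close> is within \<open>n * \<delta>\<close> of the logarithm of its
  alphabet size, the residue retains all but \<open>n * \<delta> + 1\<close> of its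
  \<open>log 2 m\<close> bits.\<close>

lemma exists_key_compression:
  fixes P :: "('x::finite \<times> 'y::finite \<times> 'z::finite) pmf" and m :: nat
  assumes code: "ni_code P n R \<delta> c" and m: "0 < m" "m \<le> card (alph_K c)"
  shows "\<exists>g :: nat \<Rightarrow> nat. (\<forall>k. g k < m) \<and> log 2 m - n * \<delta> - 1 \<le> ent (ni_law P n c) (\<lambda>w. g (KA w))"
proof -
  let ?W = "ni_law P n c" and ?M = "card (alph_K c)"
  have c: "finite_scheme c" and n: "n \<ge> 1" and R: "ent ?W KA = n * R"
    and card: "R \<ge> log 2 ?M / n - \<delta>"
    using code unfolding ni_code_def by auto
  have fin: "finite (set_pmf ?W)" using c by (intro finite_set_ni_law) auto
  have "finite (alph_K c)" using c by (simp add: finite_scheme_def)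
  then obtain e where e: "bij_betw e (alph_K c) {0..<?M}"
    using ex_bij_betw_finite_nat by blast
  let ?g = "\<lambda>k. e k mod m" and ?T = "\<lambda>w. e (KA w) div m"
  have KA: "KA w \<in> alph_K c" if "w \<in> set_pmf ?W" for w
    using KA_alph[OF that c] .
  have "ent ?W KA \<le> ent ?W (\<lambda>w. (?g (KA w), ?T w))"
  proof (rule ent_mono[OF fin])
    fix v w assume vw: "v \<in> set_pmf ?W" "w \<in> set_pmf ?W" "(?g (KA v), ?T v) = (?g (KA w), ?T w)"
    then have "e (KA v) = e (KA w)" by (metis Pair_inject div_mult_mod_eq)
    then show "KA v = KA w"
      using e KA[OF vw(1)] KA[OF vw(2)] by (meson bij_betw_imp_inj_on inj_onD)
  qed
  also have "\<dots> \<le> ent ?W (\<lambda>w. ?g (KA w)) + ent ?W ?T" by (rule ent_subadditive[OF fin])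
  also have "ent ?W ?T \<le> log 2 (card {..(?M - 1) div m})"
  proof (rule ent_le_log_card[OF fin])
    show "?T ` set_pmf ?W \<subseteq> {..(?M - 1) div m}"
    proof (rule image_subsetI)
      fix w assume "w \<in> set_pmf ?W"
      then have "e (KA w) < ?M" using bij_betwE[OF e] KA by fastforce
      then show "e (KA w) div m \<in> {..(?M - 1) div m}" by (simp add: div_le_mono)
    qed
  qed simp
  also have "\<dots> \<le> log 2 (2 * real ?M / real m)"
  proof -
    have "real ((?M - 1) div m) \<le> (?M - 1) / m" by (rule of_nat_div_le_of_nat)
    also have "\<dots> \<le> ?M / m" by (simp add: divide_right_mono)
    finally have "real ((?M - 1) div m) \<le> ?M / m" .
    moreover have "1 \<le> ?M / m" using m by simp
    ultimately have "real (card {..(?M - 1) div m}) \<le> 2 * real ?M / real m" by simp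
    then show ?thesis by (rule log_mono[rotated 2]) simp_all
  qed
  also have "\<dots> = 1 + log 2 ?M - log 2 m" using m by (simp add: log_divide log_mult)
  finally have "n * R \<le> ent ?W (\<lambda>w. ?g (KA w)) + (1 + log 2 ?M - log 2 m)"
    using R by simp
  moreover have "log 2 ?M \<le> n * R + n * \<delta>"
    using card n by (simp add: diff_le_eq pos_divide_le_eq algebra_simps)
  ultimately have "log 2 m - n * \<delta> - 1 \<le> ent ?W (\<lambda>w. ?g (KA w))" by simp
  moreover have "\<forall>k. ?g k < m" using m by simp
  ultimately show ?thesis by - (rule exI[of _ ?g], simp)
qed

text \<open>Compression makes the key alphabet small enough for the lower rate, and erasure then
  attains that rate exactly, as achievability requires.\<close>

lemma ni_code_lower_rate:
  fixes P :: "('x::finite \<times> 'y::finite \<times> 'z::finite) pmf"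
  assumes code: "ni_code P n R \<delta> c" and R': "0 \<le> R'" "R' + \<delta> + 2 / n \<le> R"
  shows "\<exists>c'. ni_code P n R' (\<delta> + 2 / n) c'"
proof -
  let ?W = "ni_law P n c" and ?M = "card (alph_K c)"
  have c: "finite_scheme c" and n: "n \<ge> 1" and R: "ent ?W KA = n * R"
    using code unfolding ni_code_def by auto
  have fin: "finite (set_pmf ?W)" using c by (intro finite_set_ni_law) auto
  have finK: "finite (alph_K c)" using c by (simp add: finite_scheme_def)
  have KA: "KA ` set_pmf ?W \<subseteq> alph_K c" using KA_alph c by blast
  then have "alph_K c \<noteq> {}" using set_pmf_not_empty[of ?W] by auto
  then have M: "?M > 0" using finK by (simp add: card_gt_0_iff)
  \<comment> \<open>The summand \<open>n * \<delta> + 1\<close> offsets the loss of the compression.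
    Rounding up to the integer \<open>m\<close> costs at most another bit, and \<open>a + 1\<close>
    equals \<open>n * (R' + (\<delta> + 2 / n))\<close>.\<close>
  define a where "a = n * R' + n * \<delta> + 1"
  define m where "m = nat \<lceil>2 powr a\<rceil>"
  have a: "a \<ge> 0" unfolding a_def using R' ni_code_delta_nonneg[OF code] by simp
  have m1: "2 powr a \<le> m" unfolding m_def by linarith
  moreover have one: "1 \<le> 2 powr a" using a by (simp add: ge_one_powr_ge_zero)
  ultimately have m0: "0 < m" by linarith
  have "real m = of_int \<lceil>2 powr a\<rceil>"
    unfolding m_def by (simp add: order.trans[OF _ less_imp_le])
  then have "real m \<le> 2 powr a + 1" using of_int_ceiling_le_add_one[of "2 powr a"] by simp
  also have "\<dots> \<le> 2 powr (a + 1)" using one by (simp add: powr_add)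
  finally have m2: "real m \<le> 2 powr (a + 1)" .
  have "a + 1 \<le> n * R"
  proof -
    have "n * (R' + \<delta> + 2 / n) \<le> n * R" using R'(2) by (rule mult_left_mono) simp
    then show ?thesis using n unfolding a_def by (simp add: algebra_simps)
  qed
  also have "\<dots> \<le> log 2 ?M" unfolding R[symmetric] by (rule ent_le_log_card[OF fin finK KA])
  finally have "2 powr (a + 1) \<le> ?M" using M by (simp add: le_log_iff)
  then have "m \<le> ?M" using m2 by linarith
  then obtain g where g: "\<And>k. g k < m" and ent: "log 2 m - n * \<delta> - 1 \<le> ent ?W (\<lambda>w. g (KA w))"
    using exists_key_compression[OF code m0] by blast
  have "a \<le> log 2 m" using m1 m0 by (simp add: le_log_iff)
  then have "n * R' \<le> ent ?W (\<lambda>w. g (KA w))" using ent unfolding a_def by simp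
  moreover have "log 2 m \<le> a + 1" using m2 m0 by (simp add: log_le_iff)
  then have "log 2 m \<le> n * (R' + (\<delta> + 2 / n))"
    using n unfolding a_def by (simp add: algebra_simps)
  moreover have "\<delta> + 1 / n \<le> \<delta> + 2 / n" by (simp add: divide_right_mono)
  ultimately show ?thesis
    by (intro ni_code_erase[OF code m0 g R'(1)])
qed

section \<open>Comparing the two suprema\<close>

lemma ni_code_mono: "ni_code P n R \<delta> c \<Longrightarrow> \<delta> \<le> \<delta>' \<Longrightarrow> ni_code P n R \<delta>' c"
  unfolding ni_code_def by auto

lemma KB_alph: "w \<in> set_pmf (ni_law P n c) \<Longrightarrow> finite_scheme c \<Longrightarrow> KB w \<in> alph_K c"
  by (auto simp: ni_law_def Let_def outcome_defs finite_scheme_def) blast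

lemma ni_achievable_0:
  fixes P :: "('x::finite \<times> 'y::finite \<times> 'z::finite) pmf"
  shows "ni_achievable P 0"
proof -
  define c :: "('x, 'y) ni_scheme" where
    "c = \<lparr>alph_F1 = {0}, alph_F2 = {0}, alph_K = {0}, enc_A = (\<lambda>_. return_pmf 0), enc_B = (\<lambda>_. return_pmf 0),
      key_A = (\<lambda>_ _ _. return_pmf 0), key_B = (\<lambda>_ _ _. return_pmf 0)\<rparr>"
  let ?W = "ni_law P 1 c"
  have c: "finite_scheme c" by (simp add: finite_scheme_def c_def)
  have K: "KA w = 0" "KB w = 0" if "w \<in> set_pmf ?W" for w
    using KA_alph[OF that c] KB_alph[OF that c] by (simp_all add: c_def)
  have fin: "finite (set_pmf ?W)" using c by (intro finite_set_ni_law) auto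
  have "KA ` set_pmf ?W \<subseteq> {0}" by (rule image_subsetI) (simp add: K)
  then have H: "ent ?W KA = 0"
    using ent_le_log_card[OF fin, of "{0}" KA] ent_nonneg[OF fin, of KA] by simp
  have "ent ?W (\<lambda>w. (Zn w, F12 w)) \<le> ent ?W (\<lambda>w. (KA w, Zn w, F12 w))"
    by (rule ent_mono[OF fin]) simp
  then have I: "mut_info ?W KA (\<lambda>w. (Zn w, F12 w)) \<le> 0"
    unfolding mut_info_eq[OF fin] using H by simp
  have "AE w in ?W. KA w = KB w" unfolding AE_measure_pmf_iff using K by metis
  then have "measure_pmf.prob ?W {w. KA w = KB w} = 1"
    by (subst measure_pmf.prob_eq_1) simp_all
  moreover have "log 2 (card (alph_K c)) = 0" by (simp add: c_def)
  ultimately have "ni_code P 1 0 \<delta> c" if "\<delta> > 0" for \<delta>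
    unfolding ni_code_def using c H I that by simp
  then show ?thesis unfolding ni_achievable_def by blast
qed

lemma S_ni_upper:
  fixes P :: "('x::finite \<times> 'y::finite \<times> 'z::finite) pmf"
  shows "ni_achievable P R \<Longrightarrow> R \<le> S_ni P"
  unfolding S_ni_def by (intro cSup_upper ni_achievable_bdd_above) simp

lemma tendsto_div_blocklength:
  assumes "filterlim n at_top sequentially"
  shows "(\<lambda>k. a / real (n k)) \<longlonglongrightarrow> 0"
  by (rule tendsto_divide_0[OF tendsto_const filterlim_at_top_imp_at_infinity])
    (rule filterlim_compose[OF filterlim_real_sequentially assms])

text \<open>Eventually the rates exceed \<open>R'\<close> by more than the loss
  \<open>\<delta> k + 2 / n k\<close>, which vanishes since blocklengths grow; lowering the rate of
  such a code gives exactly \<open>R'\<close>. Rates strictly below the limit suffice for comparing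
  suprema.\<close>

lemma ni_achievable_below_limit:
  fixes P :: "('x::finite \<times> 'y::finite \<times> 'z::finite) pmf"
  assumes code: "\<And>k. ni_code P (n k) (Rk k) (\<delta> k) (c k)"
    and n: "filterlim n at_top sequentially" and \<delta>: "\<delta> \<longlonglongrightarrow> 0" and R: "Rk \<longlonglongrightarrow> R"
    and R': "0 \<le> R'" "R' < R"
  shows "ni_achievable P R'"
  unfolding ni_achievable_def
proof (intro allI impI)
  fix \<epsilon> :: real assume \<epsilon>: "\<epsilon> > 0"
  have e: "(\<lambda>k. \<delta> k + 2 / n k) \<longlonglongrightarrow> 0"
    using tendsto_add[OF \<delta> tendsto_div_blocklength[OF n]] by simp
  then have "(\<lambda>k. Rk k - (\<delta> k + 2 / n k)) \<longlonglongrightarrow> R"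
    using tendsto_diff[OF R e] by simp
  then have "\<forall>\<^sub>F k in sequentially. R' < Rk k - (\<delta> k + 2 / n k)"
    using R'(2) by (rule order_tendstoD)
  moreover have "\<forall>\<^sub>F k in sequentially. \<delta> k + 2 / n k < \<epsilon>"
    using e \<epsilon> by (rule order_tendstoD)
  ultimately have "\<forall>\<^sub>F k in sequentially. R' < Rk k - (\<delta> k + 2 / n k) \<and> \<delta> k + 2 / n k < \<epsilon>"
    by (rule eventually_conj)
  then obtain k where k: "R' < Rk k - (\<delta> k + 2 / n k)" "\<delta> k + 2 / n k < \<epsilon>"
    using eventually_happens' sequentially_bot by blast
  then obtain c' where "ni_code P (n k) R' (\<delta> k + 2 / n k) c'"
    using ni_code_lower_rate[OF code[of k] R'(1)] by auto
  then show "\<exists>n c. ni_code P n R' \<epsilon> c"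
    using k(2) by (meson less_imp_le ni_code_mono)
qed

text \<open>Every nonnegative rate below a constrained limit is achievable, and negative ones lie
  below the achievable rate 0.\<close>

lemma S_ni_constrained_le:
  fixes P :: "('x::finite \<times> 'y::finite \<times> 'z::finite) pmf"
  shows "S_ni_constrained P \<Delta> \<le> ereal (S_ni P)"
  unfolding S_ni_constrained_def
proof (rule SUP_least, clarify)
  fix R n Rk \<delta> c L
  assume code: "\<forall>k. ni_code P (n k) (Rk k) (\<delta> k) (c k)" and n: "filterlim n at_top sequentially"
    and lim: "\<delta> \<longlonglongrightarrow> 0" "Rk \<longlonglongrightarrow> R"
  have "R' \<le> S_ni P" if "R' < R" for R'
  proof (cases "0 \<le> R'")
    case True
    then show ?thesis
      using ni_achievable_below_limit[OF spec[OF code] n lim] that by (intro S_ni_upper) blast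
  next
    case False
    then show ?thesis using S_ni_upper[OF ni_achievable_0, of P] by linarith
  qed
  then have "R \<le> S_ni P" by (rule dense_le)
  then show "ereal R \<le> ereal (S_ni P)" by simp
qed

text \<open>Long codes of exact rate \<open>R\<close> and vanishing tolerance have bounded
  normalized equivocations. The constraint asks for a limit, so a convergent subsequence is taken,
  to which the bound of \<open>ni_code_equivocation\<close> passes. The \<open>max 0\<close> in the
  hypothesis records that such a limit is nonnegative anyway.\<close>

lemma achievable_equivocation:
  fixes P :: "('x::finite \<times> 'y::finite \<times> 'z::finite) pmf"
  assumes R: "ni_achievable P R"
    and \<Delta>: "\<Delta> \<le> max 0 (max (Delta1 P) (Delta2 P) + R)"
  shows "ereal R \<le> S_ni_constrained P \<Delta>"
proof -
  have "\<forall>k::nat. \<exists>n c. k \<le> n \<and> ni_code P n R (1 / Suc k) c"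
    using ni_code_long[OF R] by simp
  then obtain n c where n: "\<And>k. k \<le> n k" and code: "\<And>k. ni_code P (n k) R (1 / Suc k) (c k)"
    by metis
  let ?X = "\<lambda>k. cond_ent (ni_law P (n k) (c k)) Zn F12 / n k"
  let ?e = "\<lambda>k. 1 / Suc k + 1 / n k + 1 / Suc k * (R + 1 / Suc k)"
  have "finite_scheme (c k)" "n k \<ge> 1" for k using code[of k] unfolding ni_code_def by auto
  then have X: "0 \<le> ?X k" "?X k \<le> log 2 CARD('z)" for k
    using cond_ent_Zn_bounds[of "c k" "n k" P] by auto
  have "bounded (range ?X)"
  proof (rule boundedI, clarify)
    show "norm (?X k) \<le> log 2 CARD('z)" for k
      using X[of k] by (simp only: real_norm_def abs_of_nonneg)
  qed
  then obtain L r where r: "strict_mono r" and L: "(?X \<circ> r) \<longlonglongrightarrow> L"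
    using bounded_imp_convergent_subsequence by blast
  have nr: "filterlim (\<lambda>k. n (r k)) at_top sequentially"
  proof (rule filterlim_at_top_mono[OF filterlim_ident])
    show "\<forall>\<^sub>F k in sequentially. k \<le> n (r k)"
      using seq_suble[OF r] n by (auto intro: always_eventually order.trans)
  qed
  have nn: "filterlim n at_top sequentially"
    by (rule filterlim_at_top_mono[OF filterlim_ident]) (simp add: n)
  have s: "(\<lambda>k. 1 / real (Suc k)) \<longlonglongrightarrow> 0"
    by (rule tendsto_div_blocklength) (rule filterlim_Suc)
  have "?e \<longlonglongrightarrow> 0 + 0 + 0 * (R + 0)"
    by (intro tendsto_intros s tendsto_div_blocklength nn)
  then have e: "(?e \<circ> r) \<longlonglongrightarrow> 0" using r by (intro LIMSEQ_subseq_LIMSEQ) simp_all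
  have "max (Delta1 P) (Delta2 P) + R \<le> L"
  proof (rule LIMSEQ_le[OF _ L])
    show "(\<lambda>k. max (Delta1 P) (Delta2 P) + R - (?e \<circ> r) k) \<longlonglongrightarrow> max (Delta1 P) (Delta2 P) + R"
      using tendsto_diff[OF tendsto_const e] by simp
    show "\<exists>N. \<forall>k\<ge>N. max (Delta1 P) (Delta2 P) + R - (?e \<circ> r) k \<le> (?X \<circ> r) k"
      using ni_code_equivocation[OF code] by simp
  qed
  moreover have "0 \<le> L"
    using X by (intro LIMSEQ_le_const[OF L]) simp
  ultimately have "\<Delta> \<le> L" using \<Delta> by simp
  moreover have "(\<lambda>k. 1 / real (Suc (r k))) \<longlonglongrightarrow> 0"
    using LIMSEQ_subseq_LIMSEQ[OF s r] by (simp add: comp_def)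
  moreover have "(\<lambda>k. ?X (r k)) \<longlonglongrightarrow> L" using L by (simp add: comp_def)
  ultimately show ?thesis
    unfolding S_ni_constrained_def using code nr
    by (intro SUP_upper CollectI exI[of _ "\<lambda>k. n (r k)"] exI[of _ "\<lambda>_. R"] exI[of _ "\<lambda>k. 1 / Suc (r k)"]
      exI[of _ "\<lambda>k. c (r k)"] exI[of _ L]) simp
qed

theorem S_ni_eq_S_ni_constrained:
  fixes P :: "('x::finite \<times> 'y::finite \<times> 'z::finite) pmf"
  shows "ereal (S_ni P) = S_ni_constrained P ((max (Delta1 P) (Delta2 P) + S_ni P) / 2)"
proof (rule antisym)
  let ?D = "max (Delta1 P) (Delta2 P)" and ?S = "S_ni P"
  have *: "ereal r \<le> S_ni_constrained P ((?D + ?S) / 2)" if r: "r < ?S" for r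
  proof -
    have "\<exists>r'. r \<le> r' \<and> r' < ?S \<and> (?D + ?S) / 2 \<le> max 0 (?D + r')"
    proof (cases "?D + ?S \<le> 0")
      case True
      then show ?thesis using r by (intro exI[of _ r]) simp
    next
      case False
      \<comment> \<open>\<open>(?S - ?D) / 2\<close> is the rate at which \<open>?D\<close> plus the
        rate equals the threshold; it lies below \<open>?S\<close> because \<open>?D + ?S\<close> is
        positive.\<close>
      have "(?S - ?D) / 2 \<le> max r ((?S - ?D) / 2)" by simp
      then have "(?D + ?S) / 2 \<le> ?D + max r ((?S - ?D) / 2)" by argo
      then have "(?D + ?S) / 2 \<le> max 0 (?D + max r ((?S - ?D) / 2))" by (rule max.coboundedI2)
      moreover have "max r ((?S - ?D) / 2) < ?S" using r False by simp
      ultimately show ?thesis by (intro exI[of _ "max r ((?S - ?D) / 2)"]) simp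
    qed
    then obtain r' where r': "r \<le> r'" "r' < ?S" "(?D + ?S) / 2 \<le> max 0 (?D + r')" by blast
    obtain R where R: "ni_achievable P R" "r' < R"
      using r'(2) less_cSupE[of r' "{R. ni_achievable P R}"] ni_achievable_0
      unfolding S_ni_def by blast
    have "(?D + ?S) / 2 \<le> max 0 (?D + R)" using r'(3) R(2) by linarith
    then have "ereal R \<le> S_ni_constrained P ((?D + ?S) / 2)" by (rule achievable_equivocation[OF R(1)])
    moreover have "ereal r \<le> ereal R" using r'(1) R(2) by simp
    ultimately show ?thesis by (rule order.trans[rotated])
  qed
  show "ereal ?S \<le> S_ni_constrained P ((?D + ?S) / 2)"
  proof (rule dense_le)
    fix w assume w: "w < ereal ?S"
    then show "w \<le> S_ni_constrained P ((?D + ?S) / 2)"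
      by (cases w) (simp_all add: *)
  qed
qed (rule S_ni_constrained_le)

theorem corollary1:
  fixes PXY :: "(bool \<times> bool) pmf" and P :: "(bool \<times> bool \<times> bool) pmf"
    and \<Delta>_bar \<Delta> :: real
  defines "P \<equiv> xor_source PXY"
  defines "\<Delta>_bar \<equiv> max (Delta1 P) (Delta2 P)"
  defines "\<Delta> \<equiv> (\<Delta>_bar + S_ni P) / 2"
  shows "ereal (S_ni P) = S_ni_constrained P \<Delta>"
  unfolding \<Delta>_def \<Delta>_bar_def by (rule S_ni_eq_S_ni_constrained)

end
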